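(* Let $\Sigma=(\mathrm{PROP},\mathrm{NOM})$ be a finite hybrid signature and let $\mathcal{F}\subseteq\{@,\downarrow,\exists,\mathrm{NOM}\}$. A first-order formula $\phi(x)$ over $\Sigma^{\circ}$ with one free variable $x$ is equivalent to the standard translation of a hybrid sentence of the hybrid language over $\Sigma$ with features from $\mathcal{F}$ (i.e. there is such a sentence $\psi$ with $\mathfrak{M}\models\phi[m]\iff\mathfrak{M},m\Vdash\psi$ for every model $\mathfrak{M}$ and every $m\in M$) if and only if $\phi(x)$ is invariant under $\mathcal{F}$-$\omega$-bisimulations.
   Context: Hybrid language. A hybrid signature is $\Sigma=(\mathrm{PROP},\mathrm{NOM})$ (propositional letters and nominals); "finite" means both sets are finite. Fix a countably infinite set $\mathrm{WVAR}=\{x_1,x_2,\dots\}$ of world variables. For $\mathcal{F}\subseteq\{@,\downarrow,\exists,\mathrm{NOM}\}$, the hybrid language with features from $\mathcal{F}$ has formulas $\varphi::=\bot\mid p\mid x\mid\neg\varphi\mid\varphi\vee\varphi\mid\Diamond\varphi$ ($p\in\mathrm{PROP}$, $x\in\mathrm{WVAR}$), together with: nominals $s\in\mathrm{NOM}$ as atoms if $\mathrm{NOM}\in\mathcal{F}$; $\downarrow x\,\varphi$ if $\downarrow\in\mathcal{F}$; $@_w\varphi$ if $@\in\mathcal{F}$, where $w\in\mathrm{WVAR}$, or $w\in\mathrm{NOM}$ if also $\mathrm{NOM}\in\mathcal{F}$; $\exists x\,\varphi$ if $\exists\in\mathcal{F}$. A model over $\Sigma$ is $\mathfrak{M}=(M,R,(s^{\mathfrak{M}})_{s\in\mathrm{NOM}},V)$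 with $R\subseteq M^2$, $s^{\mathfrak{M}}\in M$, $V:\mathrm{PROP}\to\mathcal{P}(M)$. Satisfaction $\mathfrak{M},\nu,m\Vdash\varphi$ for an assignment $\nu:\mathrm{WVAR}\to M$ and $m\in M$ is standard: $p$ iff $m\in V(p)$; $s$ iff $m=s^{\mathfrak{M}}$; $x$ iff $m=\nu(x)$; Boolean clauses as usual; $\Diamond\varphi$ iff $\varphi$ holds at some $m'$ with $mRm'$; $\downarrow x\,\varphi$ iff $\varphi$ holds at $m$ under $\nu[x\mapsto m]$; $@_s\varphi$ iff $\varphi$ holds at $s^{\mathfrak{M}}$; $@_x\varphi$ iff $\varphi$ holds at $\nu(x)$; $\exists x\,\varphi$ iff $\varphi$ holds at $m$ under $\nu[x\mapsto n]$ for some $n\in M$. The operators $\downarrow x$ and $\exists x$ bind $x$ ($@_x$ does not); a hybrid sentence has no free world variables and we write $\mathfrak{M},m\Vdash\varphi$. First-order side. $\Sigma^{\circ}$ is the first-order signature with a binary relation $R$, a unary predicate $P$ for each $p\in\mathrm{PROP}$ and a constant for each nominal; $\Sigma^{\circ}$-structures are identified with models over $\Sigma$. The standard translation $\mathrm{ST}_x(\psi)$ of a hybrid sentence $\psi$ is a first-order $\Sigma^{\circ}$-formula with free variable $x$ satisfying $\mathfrak{M},m\Vdash\psi\iff\mathfrak{M}\models\mathrm{ST}_x(\psi)[m]$. Notation. For $\vec m=(m_1,\dots,m_k)\in M^k$, $\vec m(j)=m_j$; $\vec m^{\,j}_{n}$ is $\vec m$ with its $j$-th entry replaced by $n$; $\vec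 m\cdot m\in M^{k+1}$ is concatenation; $\lambda$ is the empty sequence. $\mathcal{F}$-$\omega$-bisimulation. Between models $\mathfrak{M},\mathfrak{N}$ over $\Sigma$ it is a non-empty family $(B_k)_{k\in\omega}$ with $B_k\subseteq(M^k\times M)\times(N^k\times N)$ such that for every $k$ and every $((\vec m,m),(\vec n,n))\in B_k$: (prop) $m\in V^{\mathfrak{M}}(p)\iff n\in V^{\mathfrak{N}}(p)$ for all $p$; (wvar) $\vec m(j)=m\iff\vec n(j)=n$ for all $1\le j\le k$; (forth) for every $m'$ with $mRm'$ there is $n'$ with $nRn'$ and $((\vec m,m'),(\vec n,n'))\in B_k$; (back) symmetrically; (ext) $((\vec m\cdot m,m),(\vec n\cdot n,n))\in B_{k+1}$; and additionally the following conditions according to $\mathcal{F}$: (nom), required if $\mathrm{NOM}\in\mathcal{F}$: $m=s^{\mathfrak{M}}\iff n=s^{\mathfrak{N}}$ for every $s\in\mathrm{NOM}$; (bind), required if $\downarrow\in\mathcal{F}$ or $\{\exists,@,\mathrm{NOM}\}\subseteq\mathcal{F}$: $((\vec m^{\,j}_m,m),(\vec n^{\,j}_n,n))\in B_k$ for all $1\le j\le k$; (atv), required if $@\in\mathcal{F}$: $((\vec m,\vec m(j)),(\vec n,\vec n(j)))\in B_k$ for all $1\le j\le k$; (atn), required if $\{@,\mathrm{NOM}\}\subseteq\mathcal{F}$: $((\vec m,s^{\mathfrak{M}}),(\vec n,s^{\mathfrak{N}}))\in B_k$ for all $s\in\mathrm{NOM}$; (ex), required if $\exists\in\mathcal{F}$: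 for all $1\le j\le k$, for every $u\in M$ there is $u'\in N$ with $((\vec m^{\,j}_u,m),(\vec n^{\,j}_{u'},n))\in B_k$, and for every $u'\in N$ there is $u\in M$ with the same property. Invariance. $\phi(x)$ is invariant under $\mathcal{F}$-$\omega$-bisimulations if whenever $(B_k)_{k\in\omega}$ is an $\mathcal{F}$-$\omega$-bisimulation between $\mathfrak{M}$ and $\mathfrak{N}$ with $((\lambda,m),(\lambda,n))\in B_0$, then $\mathfrak{M}\models\phi[m]\iff\mathfrak{N}\models\phi[n]$.
   Formalization: "Invariant implies definable" is claimed only if F contains ↓ or ∃: otherwise it fails, as (ext) makes R(x,x) invariant though no binder-free sentence defines it. Models live in an arbitrary infinite set; all models follow by Löwenheim–Skolem. *)

theory Defs
  imports Main
begin

section \<open>Signatures and models\<close>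

text \<open>A hybrid signature is a pair of sets \<open>PROPS :: 'p set\<close>, \<open>NOMS :: 'n set\<close>; either may be empty.
  Models have a carrier set inside an ambient type \<open>'u\<close>, since types cannot be quantified
  over. Every model, and every set of models, has an isomorphic copy inside some type \<open>'u\<close>;
  results about all models are stated for an arbitrary infinite type \<open>'u\<close>.
  Interpretations of symbols outside the signature are irrelevant.\<close>

record ('u, 'p, 'n) model =
  carrier :: "'u set"
  rel :: "('u \<times> 'u) set"
  nomi :: "'n \<Rightarrow> 'u"
  val :: "'p \<Rightarrow> 'u set"

definition model_over :: "'p set \<Rightarrow> 'n set \<Rightarrow> ('u, 'p, 'n) model \<Rightarrow> bool" where
  "model_over PROPS NOMS M \<longleftrightarrow>
     carrier M \<noteq> {} \<and>
     rel M \<subseteq> carrier M \<times> carrier M \<and>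
     (\<forall>s\<in>NOMS. nomi M s \<in> carrier M) \<and>
     (\<forall>p\<in>PROPS. val M p \<subseteq> carrier M)"


section \<open>Hybrid languages\<close>

datatype feature = At | Down | Ex | Nom

text \<open>World variables are natural numbers. \<open>HAtVar w\<close> and \<open>HAtNom s\<close> are the two forms of the
  satisfaction operator.\<close>

datatype ('p, 'n) hform =
    HBot
  | HProp 'p
  | HVar nat
  | HNeg "('p, 'n) hform"
  | HOr "('p, 'n) hform" "('p, 'n) hform"
  | HDia "('p, 'n) hform"
  | HNom 'n
  | HDown nat "('p, 'n) hform"
  | HAtVar nat "('p, 'n) hform"
  | HAtNom 'n "('p, 'n) hform"
  | HEx nat "('p, 'n) hform"

primrec hform_over :: "feature set \<Rightarrow> 'p set \<Rightarrow> 'n set \<Rightarrow> ('p, 'n) hform \<Rightarrow> bool" where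
  "hform_over F PROPS NOMS HBot \<longleftrightarrow> True"
| "hform_over F PROPS NOMS (HProp p) \<longleftrightarrow> p \<in> PROPS"
| "hform_over F PROPS NOMS (HVar w) \<longleftrightarrow> True"
| "hform_over F PROPS NOMS (HNeg \<psi>) \<longleftrightarrow> hform_over F PROPS NOMS \<psi>"
| "hform_over F PROPS NOMS (HOr \<psi> \<chi>) \<longleftrightarrow> hform_over F PROPS NOMS \<psi> \<and> hform_over F PROPS NOMS \<chi>"
| "hform_over F PROPS NOMS (HDia \<psi>) \<longleftrightarrow> hform_over F PROPS NOMS \<psi>"
| "hform_over F PROPS NOMS (HNom s) \<longleftrightarrow> Nom \<in> F \<and> s \<in> NOMS"
| "hform_over F PROPS NOMS (HDown w \<psi>) \<longleftrightarrow> Down \<in> F \<and> hform_over F PROPS NOMS \<psi>"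
| "hform_over F PROPS NOMS (HAtVar w \<psi>) \<longleftrightarrow> At \<in> F \<and> hform_over F PROPS NOMS \<psi>"
| "hform_over F PROPS NOMS (HAtNom s \<psi>) \<longleftrightarrow>
     At \<in> F \<and> Nom \<in> F \<and> s \<in> NOMS \<and> hform_over F PROPS NOMS \<psi>"
| "hform_over F PROPS NOMS (HEx w \<psi>) \<longleftrightarrow> Ex \<in> F \<and> hform_over F PROPS NOMS \<psi>"

primrec hfv :: "('p, 'n) hform \<Rightarrow> nat set" where
  "hfv HBot = {}"
| "hfv (HProp p) = {}"
| "hfv (HVar w) = {w}"
| "hfv (HNeg \<psi>) = hfv \<psi>"
| "hfv (HOr \<psi> \<chi>) = hfv \<psi> \<union> hfv \<chi>"
| "hfv (HDia \<psi>) = hfv \<psi>"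
| "hfv (HNom s) = {}"
| "hfv (HDown w \<psi>) = hfv \<psi> - {w}"
| "hfv (HAtVar w \<psi>) = insert w (hfv \<psi>)"
| "hfv (HAtNom s \<psi>) = hfv \<psi>"
| "hfv (HEx w \<psi>) = hfv \<psi> - {w}"

definition hsentence :: "feature set \<Rightarrow> 'p set \<Rightarrow> 'n set \<Rightarrow> ('p, 'n) hform \<Rightarrow> bool" where
  "hsentence F PROPS NOMS \<psi> \<longleftrightarrow> hform_over F PROPS NOMS \<psi> \<and> hfv \<psi> = {}"

primrec hsat :: "('u, 'p, 'n) model \<Rightarrow> (nat \<Rightarrow> 'u) \<Rightarrow> 'u \<Rightarrow> ('p, 'n) hform \<Rightarrow> bool" where
  "hsat M \<nu> m HBot \<longleftrightarrow> False"
| "hsat M \<nu> m (HProp p) \<longleftrightarrow> m \<in> val M p"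
| "hsat M \<nu> m (HVar w) \<longleftrightarrow> m = \<nu> w"
| "hsat M \<nu> m (HNeg \<psi>) \<longleftrightarrow> \<not> hsat M \<nu> m \<psi>"
| "hsat M \<nu> m (HOr \<psi> \<chi>) \<longleftrightarrow> hsat M \<nu> m \<psi> \<or> hsat M \<nu> m \<chi>"
| "hsat M \<nu> m (HDia \<psi>) \<longleftrightarrow> (\<exists>m'. (m, m') \<in> rel M \<and> hsat M \<nu> m' \<psi>)"
| "hsat M \<nu> m (HNom s) \<longleftrightarrow> m = nomi M s"
| "hsat M \<nu> m (HDown w \<psi>) \<longleftrightarrow> hsat M (\<nu>(w := m)) m \<psi>"
| "hsat M \<nu> m (HAtVar w \<psi>) \<longleftrightarrow> hsat M \<nu> (\<nu> w) \<psi>"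
| "hsat M \<nu> m (HAtNom s \<psi>) \<longleftrightarrow> hsat M \<nu> (nomi M s) \<psi>"
| "hsat M \<nu> m (HEx w \<psi>) \<longleftrightarrow> (\<exists>n\<in>carrier M. hsat M (\<nu>(w := n)) m \<psi>)"

text \<open>Truth of a sentence at a world; the assignment is immaterial (see \<open>hsat_cong\<close>), the
  constant one is a legitimate assignment in every model containing \<open>m\<close>.\<close>

definition htrue :: "('u, 'p, 'n) model \<Rightarrow> 'u \<Rightarrow> ('p, 'n) hform \<Rightarrow> bool" where
  "htrue M m \<psi> \<longleftrightarrow> hsat M (\<lambda>_. m) m \<psi>"

lemma hsat_cong:
  "(\<And>w. w \<in> hfv \<psi> \<Longrightarrow> \<nu> w = \<nu>' w) \<Longrightarrow> hsat M \<nu> m \<psi> \<longleftrightarrow> hsat M \<nu>' m \<psi>"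
proof (induction \<psi> arbitrary: \<nu> \<nu>' m)
  case (HDown w \<psi>)
  have "hsat M (\<nu>(w := m)) m \<psi> \<longleftrightarrow> hsat M (\<nu>'(w := m)) m \<psi>"
    by (rule HDown.IH) (use HDown.prems in auto)
  then show ?case by simp
next
  case (HEx w \<psi>)
  have "hsat M (\<nu>(w := n)) m \<psi> \<longleftrightarrow> hsat M (\<nu>'(w := n)) m \<psi>" for n
    by (rule HEx.IH) (use HEx.prems in auto)
  then show ?case by simp
next
  case (HOr \<psi> \<chi>)
  have "hsat M \<nu> m \<psi> \<longleftrightarrow> hsat M \<nu>' m \<psi>" "hsat M \<nu> m \<chi> \<longleftrightarrow> hsat M \<nu>' m \<chi>"
    by (rule HOr.IH; use HOr.prems in auto)+
  then show ?case by simp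
next
  case (HDia \<psi>)
  have "hsat M \<nu> n \<psi> \<longleftrightarrow> hsat M \<nu>' n \<psi>" for n
    by (rule HDia.IH) (use HDia.prems in auto)
  then show ?case by simp
next
  case (HAtVar w \<psi>)
  have "hsat M \<nu> n \<psi> \<longleftrightarrow> hsat M \<nu>' n \<psi>" for n
    by (rule HAtVar.IH) (use HAtVar.prems in auto)
  then show ?case using HAtVar.prems by simp
next
  case (HNeg \<psi>)
  have "hsat M \<nu> m \<psi> \<longleftrightarrow> hsat M \<nu>' m \<psi>"
    by (rule HNeg.IH) (use HNeg.prems in auto)
  then show ?case by simp
next
  case (HAtNom s \<psi>)
  have "hsat M \<nu> (nomi M s) \<psi> \<longleftrightarrow> hsat M \<nu>' (nomi M s) \<psi>"
    by (rule HAtNom.IH) (use HAtNom.prems in auto)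
  then show ?case by simp
qed simp_all


section \<open>First-order logic over the corresponding first-order signature\<close>

datatype 'n fo_term = FVar nat | FConst 'n

datatype ('p, 'n) fo =
    FBot
  | FEq "'n fo_term" "'n fo_term"
  | FRel "'n fo_term" "'n fo_term"
  | FPred 'p "'n fo_term"
  | FNeg "('p, 'n) fo"
  | FOr "('p, 'n) fo" "('p, 'n) fo"
  | FEx nat "('p, 'n) fo"

primrec term_over :: "'n set \<Rightarrow> 'n fo_term \<Rightarrow> bool" where
  "term_over NOMS (FVar i) \<longleftrightarrow> True"
| "term_over NOMS (FConst s) \<longleftrightarrow> s \<in> NOMS"

primrec fo_over :: "'p set \<Rightarrow> 'n set \<Rightarrow> ('p, 'n) fo \<Rightarrow> bool" where
  "fo_over PROPS NOMS FBot \<longleftrightarrow> True"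
| "fo_over PROPS NOMS (FEq t u) \<longleftrightarrow> term_over NOMS t \<and> term_over NOMS u"
| "fo_over PROPS NOMS (FRel t u) \<longleftrightarrow> term_over NOMS t \<and> term_over NOMS u"
| "fo_over PROPS NOMS (FPred p t) \<longleftrightarrow> p \<in> PROPS \<and> term_over NOMS t"
| "fo_over PROPS NOMS (FNeg \<phi>) \<longleftrightarrow> fo_over PROPS NOMS \<phi>"
| "fo_over PROPS NOMS (FOr \<phi> \<chi>) \<longleftrightarrow> fo_over PROPS NOMS \<phi> \<and> fo_over PROPS NOMS \<chi>"
| "fo_over PROPS NOMS (FEx i \<phi>) \<longleftrightarrow> fo_over PROPS NOMS \<phi>"

primrec term_fv :: "'n fo_term \<Rightarrow> nat set" where
  "term_fv (FVar i) = {i}"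
| "term_fv (FConst s) = {}"

primrec fo_fv :: "('p, 'n) fo \<Rightarrow> nat set" where
  "fo_fv FBot = {}"
| "fo_fv (FEq t u) = term_fv t \<union> term_fv u"
| "fo_fv (FRel t u) = term_fv t \<union> term_fv u"
| "fo_fv (FPred p t) = term_fv t"
| "fo_fv (FNeg \<phi>) = fo_fv \<phi>"
| "fo_fv (FOr \<phi> \<chi>) = fo_fv \<phi> \<union> fo_fv \<chi>"
| "fo_fv (FEx i \<phi>) = fo_fv \<phi> - {i}"

primrec term_val :: "('u, 'p, 'n) model \<Rightarrow> (nat \<Rightarrow> 'u) \<Rightarrow> 'n fo_term \<Rightarrow> 'u" where
  "term_val M \<mu> (FVar i) = \<mu> i"
| "term_val M \<mu> (FConst s) = nomi M s"

primrec fo_sat :: "('u, 'p, 'n) model \<Rightarrow> (nat \<Rightarrow> 'u) \<Rightarrow> ('p, 'n) fo \<Rightarrow> bool" where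
  "fo_sat M \<mu> FBot \<longleftrightarrow> False"
| "fo_sat M \<mu> (FEq t u) \<longleftrightarrow> term_val M \<mu> t = term_val M \<mu> u"
| "fo_sat M \<mu> (FRel t u) \<longleftrightarrow> (term_val M \<mu> t, term_val M \<mu> u) \<in> rel M"
| "fo_sat M \<mu> (FPred p t) \<longleftrightarrow> term_val M \<mu> t \<in> val M p"
| "fo_sat M \<mu> (FNeg \<phi>) \<longleftrightarrow> \<not> fo_sat M \<mu> \<phi>"
| "fo_sat M \<mu> (FOr \<phi> \<chi>) \<longleftrightarrow> fo_sat M \<mu> \<phi> \<or> fo_sat M \<mu> \<chi>"
| "fo_sat M \<mu> (FEx i \<phi>) \<longleftrightarrow> (\<exists>u\<in>carrier M. fo_sat M (\<mu>(i := u)) \<phi>)"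

definition FAnd :: "('p, 'n) fo \<Rightarrow> ('p, 'n) fo \<Rightarrow> ('p, 'n) fo" where
  "FAnd \<phi> \<chi> = FNeg (FOr (FNeg \<phi>) (FNeg \<chi>))"

text \<open>\<open>fo_true M m \<phi>\<close> is meant for formulas with at most one free variable: whatever that
  variable is, it is assigned \<open>m\<close>.\<close>

definition fo_true :: "('u, 'p, 'n) model \<Rightarrow> 'u \<Rightarrow> ('p, 'n) fo \<Rightarrow> bool" where
  "fo_true M m \<phi> \<longleftrightarrow> fo_sat M (\<lambda>_. m) \<phi>"


section \<open>Standard translation\<close>

text \<open>In \<open>st h \<psi> a b\<close> the first-order variable \<open>a\<close> denotes the current world, \<open>b\<close> is the
  spare variable for the next one, and the world variable \<open>w\<close> becomes the first-order variable
  \<open>h w\<close>.\<close>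

primrec st :: "(nat \<Rightarrow> nat) \<Rightarrow> ('p, 'n) hform \<Rightarrow> nat \<Rightarrow> nat \<Rightarrow> ('p, 'n) fo" where
  "st h HBot = (\<lambda>a b. FBot)"
| "st h (HProp p) = (\<lambda>a b. FPred p (FVar a))"
| "st h (HVar w) = (\<lambda>a b. FEq (FVar a) (FVar (h w)))"
| "st h (HNeg \<psi>) = (\<lambda>a b. FNeg (st h \<psi> a b))"
| "st h (HOr \<psi> \<chi>) = (\<lambda>a b. FOr (st h \<psi> a b) (st h \<chi> a b))"
| "st h (HDia \<psi>) = (\<lambda>a b. FEx b (FAnd (FRel (FVar a) (FVar b)) (st h \<psi> b a)))"
| "st h (HNom s) = (\<lambda>a b. FEq (FVar a) (FConst s))"
| "st h (HDown w \<psi>) = (\<lambda>a b. FEx (h w) (FAnd (FEq (FVar (h w)) (FVar a)) (st h \<psi> a b)))"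
| "st h (HAtVar w \<psi>) = (\<lambda>a b. FEx b (FAnd (FEq (FVar b) (FVar (h w))) (st h \<psi> b a)))"
| "st h (HAtNom s \<psi>) = (\<lambda>a b. FEx b (FAnd (FEq (FVar b) (FConst s)) (st h \<psi> b a)))"
| "st h (HEx w \<psi>) = (\<lambda>a b. FEx (h w) (st h \<psi> a b))"

definition ST :: "nat \<Rightarrow> ('p, 'n) hform \<Rightarrow> ('p, 'n) fo" where
  "ST x \<psi> = st (\<lambda>w. x + 2 + w) \<psi> x (x + 1)"

lemma fo_sat_FAnd [simp]: "fo_sat M \<mu> (FAnd \<phi> \<chi>) \<longleftrightarrow> fo_sat M \<mu> \<phi> \<and> fo_sat M \<mu> \<chi>"
  by (simp add: FAnd_def)

lemma fo_fv_FAnd [simp]: "fo_fv (FAnd \<phi> \<chi>) = fo_fv \<phi> \<union> fo_fv \<chi>"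
  by (simp add: FAnd_def)

lemma fo_over_FAnd [simp]:
  "fo_over PROPS NOMS (FAnd \<phi> \<chi>) \<longleftrightarrow> fo_over PROPS NOMS \<phi> \<and> fo_over PROPS NOMS \<chi>"
  by (simp add: FAnd_def)

lemma fo_over_st: "hform_over F PROPS NOMS \<psi> \<Longrightarrow> fo_over PROPS NOMS (st h \<psi> a b)"
  by (induction \<psi> arbitrary: a b) auto

lemma fo_fv_st: "a \<noteq> b \<Longrightarrow> fo_fv (st h \<psi> a b) \<subseteq> insert a (h ` hfv \<psi>)"
proof (induction \<psi> arbitrary: a b)
  case (HDia \<psi>)
  have "fo_fv (st h \<psi> b a) \<subseteq> insert b (h ` hfv \<psi>)"
    by (rule HDia.IH) (use HDia.prems in simp)
  then show ?case by auto
next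
  case (HDown w \<psi>)
  have "fo_fv (st h \<psi> a b) \<subseteq> insert a (h ` hfv \<psi>)"
    by (rule HDown.IH) (use HDown.prems in simp)
  then show ?case by auto
next
  case (HAtVar w \<psi>)
  have "fo_fv (st h \<psi> b a) \<subseteq> insert b (h ` hfv \<psi>)"
    by (rule HAtVar.IH) (use HAtVar.prems in simp)
  then show ?case by auto
next
  case (HAtNom s \<psi>)
  have "fo_fv (st h \<psi> b a) \<subseteq> insert b (h ` hfv \<psi>)"
    by (rule HAtNom.IH) (use HAtNom.prems in simp)
  then show ?case by auto
next
  case (HEx w \<psi>)
  have "fo_fv (st h \<psi> a b) \<subseteq> insert a (h ` hfv \<psi>)"
    by (rule HEx.IH) (use HEx.prems in simp)
  then show ?case by auto
next
  case (HOr \<psi> \<chi>)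
  have "fo_fv (st h \<psi> a b) \<subseteq> insert a (h ` hfv \<psi>)" "fo_fv (st h \<chi> a b) \<subseteq> insert a (h ` hfv \<chi>)"
    using HOr by blast+
  then show ?case by auto
qed auto

lemma ST_sentence:
  assumes "hsentence F PROPS NOMS \<psi>"
  shows "fo_over PROPS NOMS (ST x \<psi>)" "fo_fv (ST x \<psi>) \<subseteq> {x}"
proof -
  show "fo_over PROPS NOMS (ST x \<psi>)"
    using assms by (auto simp: hsentence_def ST_def intro: fo_over_st)
  have "fo_fv (ST x \<psi>) \<subseteq> insert x ((\<lambda>w. x + 2 + w) ` hfv \<psi>)"
    unfolding ST_def by (rule fo_fv_st) simp
  then show "fo_fv (ST x \<psi>) \<subseteq> {x}"
    using assms by (simp add: hsentence_def)
qed

lemma st_correct: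
  assumes "model_over PROPS NOMS M" "inj h"
  shows "hform_over F PROPS NOMS \<psi> \<Longrightarrow> range \<mu> \<subseteq> carrier M \<Longrightarrow> a \<noteq> b \<Longrightarrow>
    a \<notin> range h \<Longrightarrow> b \<notin> range h \<Longrightarrow>
    fo_sat M \<mu> (st h \<psi> a b) \<longleftrightarrow> hsat M (\<mu> \<circ> h) (\<mu> a) \<psi>"
proof (induction \<psi> arbitrary: \<mu> a b)
  case (HDia \<psi>)
  have "fo_sat M (\<mu>(b := u)) (st h \<psi> b a) \<longleftrightarrow> hsat M (\<mu> \<circ> h) u \<psi>" if "u \<in> carrier M" for u
  proof -
    have "\<mu>(b := u) \<circ> h = \<mu> \<circ> h" using HDia.prems by (auto simp: fun_eq_iff)
    moreover have "fo_sat M (\<mu>(b := u)) (st h \<psi> b a)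
        \<longleftrightarrow> hsat M (\<mu>(b := u) \<circ> h) ((\<mu>(b := u)) b) \<psi>"
      by (rule HDia.IH) (use HDia.prems that in auto)
    ultimately show ?thesis by simp
  qed
  moreover have "rel M \<subseteq> carrier M \<times> carrier M"
    using assms by (simp add: model_over_def)
  ultimately show ?case using HDia.prems by (auto simp: comp_def)
next
  case (HDown w \<psi>)
  have eq: "\<mu>(h w := \<mu> a) \<circ> h = (\<mu> \<circ> h)(w := \<mu> a)"
    using assms(2) by (simp add: fun_eq_iff inj_eq)
  have "h w \<noteq> a" using HDown.prems by auto
  moreover have "fo_sat M (\<mu>(h w := \<mu> a)) (st h \<psi> a b)
      \<longleftrightarrow> hsat M (\<mu>(h w := \<mu> a) \<circ> h) ((\<mu>(h w := \<mu> a)) a) \<psi>"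
    by (rule HDown.IH) (use HDown.prems in auto)
  ultimately show ?case using eq HDown.prems by (auto simp: comp_def)
next
  case (HAtVar w \<psi>)
  have "\<mu>(b := \<mu> (h w)) \<circ> h = \<mu> \<circ> h" using HAtVar.prems by (auto simp: fun_eq_iff)
  moreover have "fo_sat M (\<mu>(b := \<mu> (h w))) (st h \<psi> b a)
      \<longleftrightarrow> hsat M (\<mu>(b := \<mu> (h w)) \<circ> h) ((\<mu>(b := \<mu> (h w))) b) \<psi>"
    by (rule HAtVar.IH) (use HAtVar.prems in auto)
  ultimately have "fo_sat M (\<mu>(b := \<mu> (h w))) (st h \<psi> b a) \<longleftrightarrow> hsat M (\<mu> \<circ> h) (\<mu> (h w)) \<psi>"
    by simp
  moreover have "h w \<noteq> b" using HAtVar.prems by auto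
  ultimately show ?case using HAtVar.prems by (auto simp: comp_def)
next
  case (HAtNom s \<psi>)
  have s: "nomi M s \<in> carrier M" using assms(1) HAtNom.prems by (auto simp: model_over_def)
  have "\<mu>(b := nomi M s) \<circ> h = \<mu> \<circ> h" using HAtNom.prems by (auto simp: fun_eq_iff)
  moreover have "fo_sat M (\<mu>(b := nomi M s)) (st h \<psi> b a)
      \<longleftrightarrow> hsat M (\<mu>(b := nomi M s) \<circ> h) ((\<mu>(b := nomi M s)) b) \<psi>"
    by (rule HAtNom.IH) (use HAtNom.prems s in auto)
  ultimately have "fo_sat M (\<mu>(b := nomi M s)) (st h \<psi> b a) \<longleftrightarrow> hsat M (\<mu> \<circ> h) (nomi M s) \<psi>"
    by simp
  then show ?case using s by (simp add: comp_def)
next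
  case (HEx w \<psi>)
  have eq: "\<mu>(h w := u) \<circ> h = (\<mu> \<circ> h)(w := u)" for u
    using assms(2) by (simp add: fun_eq_iff inj_eq)
  have "h w \<noteq> a" using HEx.prems by auto
  moreover have "fo_sat M (\<mu>(h w := u)) (st h \<psi> a b)
      \<longleftrightarrow> hsat M (\<mu>(h w := u) \<circ> h) ((\<mu>(h w := u)) a) \<psi>" if "u \<in> carrier M" for u
    by (rule HEx.IH) (use HEx.prems that in auto)
  ultimately show ?case using eq by (auto simp: comp_def)
qed auto

theorem ST_correct:
  assumes "model_over PROPS NOMS M" "m \<in> carrier M" "hsentence F PROPS NOMS \<psi>"
  shows "fo_true M m (ST x \<psi>) \<longleftrightarrow> htrue M m \<psi>"
proof -
  have "fo_sat M (\<lambda>_. m) (ST x \<psi>) \<longleftrightarrow> hsat M ((\<lambda>_. m) \<circ> (\<lambda>w. x + 2 + w)) m \<psi>"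
    unfolding ST_def
    by (rule st_correct[of PROPS NOMS _ _ F]) (use assms in \<open>auto simp: hsentence_def inj_def\<close>)
  then show ?thesis by (simp add: fo_true_def htrue_def comp_def)
qed


section \<open>\<open>\<omega>\<close>-bisimulations\<close>

text \<open>A \<open>k\<close>-tuple is a list of length \<open>k\<close>; its entries are indexed from \<open>0\<close>.\<close>

definition omega_bisim ::
  "feature set \<Rightarrow> 'p set \<Rightarrow> 'n set \<Rightarrow> ('u, 'p, 'n) model \<Rightarrow> ('v, 'p, 'n) model \<Rightarrow>
   (nat \<Rightarrow> (('u list \<times> 'u) \<times> ('v list \<times> 'v)) set) \<Rightarrow> bool" where
  "omega_bisim F PROPS NOMS M N B \<longleftrightarrow>
    (\<exists>k. B k \<noteq> {}) \<and>
    (\<forall>k ms m ns n. ((ms, m), (ns, n)) \<in> B k \<longrightarrow>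
      length ms = k \<and> set ms \<subseteq> carrier M \<and> m \<in> carrier M \<and>
      length ns = k \<and> set ns \<subseteq> carrier N \<and> n \<in> carrier N \<and>
      \<comment> \<open>prop\<close>
      (\<forall>p\<in>PROPS. m \<in> val M p \<longleftrightarrow> n \<in> val N p) \<and>
      \<comment> \<open>wvar\<close>
      (\<forall>j<k. ms ! j = m \<longleftrightarrow> ns ! j = n) \<and>
      \<comment> \<open>forth\<close>
      (\<forall>m'. (m, m') \<in> rel M \<longrightarrow> (\<exists>n'. (n, n') \<in> rel N \<and> ((ms, m'), (ns, n')) \<in> B k)) \<and>
      \<comment> \<open>back\<close>
      (\<forall>n'. (n, n') \<in> rel N \<longrightarrow> (\<exists>m'. (m, m') \<in> rel M \<and> ((ms, m'), (ns, n')) \<in> B k)) \<and>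
      \<comment> \<open>ext\<close>
      ((ms @ [m], m), (ns @ [n], n)) \<in> B (Suc k) \<and>
      \<comment> \<open>nom\<close>
      (Nom \<in> F \<longrightarrow> (\<forall>s\<in>NOMS. m = nomi M s \<longleftrightarrow> n = nomi N s)) \<and>
      \<comment> \<open>bind\<close>
      (Down \<in> F \<or> {Ex, At, Nom} \<subseteq> F \<longrightarrow>
        (\<forall>j<k. ((ms[j := m], m), (ns[j := n], n)) \<in> B k)) \<and>
      \<comment> \<open>atv\<close>
      (At \<in> F \<longrightarrow> (\<forall>j<k. ((ms, ms ! j), (ns, ns ! j)) \<in> B k)) \<and>
      \<comment> \<open>atn\<close>
      ({At, Nom} \<subseteq> F \<longrightarrow> (\<forall>s\<in>NOMS. ((ms, nomi M s), (ns, nomi N s)) \<in> B k)) \<and>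
      \<comment> \<open>ex\<close>
      (Ex \<in> F \<longrightarrow> (\<forall>j<k.
        (\<forall>u\<in>carrier M. \<exists>u'\<in>carrier N. ((ms[j := u], m), (ns[j := u'], n)) \<in> B k) \<and>
        (\<forall>u'\<in>carrier N. \<exists>u\<in>carrier M. ((ms[j := u], m), (ns[j := u'], n)) \<in> B k))))"

definition omega_bisim_invariant ::
  "'u itself \<Rightarrow> feature set \<Rightarrow> 'p set \<Rightarrow> 'n set \<Rightarrow> ('p, 'n) fo \<Rightarrow> bool" where
  "omega_bisim_invariant (_ :: 'u itself) F PROPS NOMS \<phi> \<longleftrightarrow>
    (\<forall>(M :: ('u, 'p, 'n) model) (N :: ('u, 'p, 'n) model) B m n.
      model_over PROPS NOMS M \<longrightarrow> model_over PROPS NOMS N \<longrightarrow>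
      omega_bisim F PROPS NOMS M N B \<longrightarrow> (([], m), ([], n)) \<in> B 0 \<longrightarrow>
      (fo_true M m \<phi> \<longleftrightarrow> fo_true N n \<phi>))"

definition equiv_to_ST_of ::
  "'u itself \<Rightarrow> 'p set \<Rightarrow> 'n set \<Rightarrow> nat \<Rightarrow> ('p, 'n) fo \<Rightarrow> ('p, 'n) hform \<Rightarrow> bool" where
  "equiv_to_ST_of (_ :: 'u itself) PROPS NOMS x \<phi> \<psi> \<longleftrightarrow>
    (\<forall>(M :: ('u, 'p, 'n) model) m. model_over PROPS NOMS M \<longrightarrow> m \<in> carrier M \<longrightarrow>
      (fo_true M m \<phi> \<longleftrightarrow> fo_true M m (ST x \<psi>)))"

lemma equiv_to_ST_of_iff_htrue:
  fixes PROPS :: "'p set" and NOMS :: "'n set"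
  assumes "hsentence F PROPS NOMS \<psi>"
  shows "equiv_to_ST_of TYPE('u) PROPS NOMS x \<phi> \<psi> \<longleftrightarrow>
    (\<forall>(M :: ('u, 'p, 'n) model) m. model_over PROPS NOMS M \<longrightarrow> m \<in> carrier M \<longrightarrow>
      (fo_true M m \<phi> \<longleftrightarrow> htrue M m \<psi>))"
  by (simp add: equiv_to_ST_of_def ST_correct[OF _ _ assms])


section \<open>Fragments without a binder\<close>

text \<open>Since (ext) is required for every feature set, \<open>R(x,x)\<close> is invariant under every kind of
  \<open>\<omega>\<close>-bisimulation: (ext) stores the current world and (wvar) compares its successors with it.
  But if neither \<open>\<down>\<close> nor \<open>\<exists>\<close> is available, sentences contain no world variables at all and
  cannot separate a reflexive point from a point on a two-cycle. So the implication
  from invariance to definability fails, over every signature, for each feature set without a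
  binder; the converse implication is not affected.\<close>

lemma FRel_invariant:
  fixes PROPS :: "'p set" and NOMS :: "'n set"
  shows "omega_bisim_invariant TYPE('u) F PROPS NOMS (FRel (FVar x) (FVar x))"
  unfolding omega_bisim_invariant_def
proof (intro allI impI)
  fix M N :: "('u, 'p, 'n) model" and B m n
  assume bis: "omega_bisim F PROPS NOMS M N B" and 0: "(([], m), ([], n)) \<in> B 0"
  have ext: "((ms @ [m], m), (ns @ [n], n)) \<in> B (Suc k)" if "((ms, m), (ns, n)) \<in> B k" for k ms m ns n
    using bis[unfolded omega_bisim_def, THEN conjunct2, THEN spec, THEN spec, THEN spec, THEN spec,
        THEN spec, THEN mp, OF that] by (elim conjE)
  have wvar: "\<forall>j<k. ms ! j = m \<longleftrightarrow> ns ! j = n" if "((ms, m), (ns, n)) \<in> B k" for k ms m ns n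
    using bis[unfolded omega_bisim_def, THEN conjunct2, THEN spec, THEN spec, THEN spec, THEN spec,
        THEN spec, THEN mp, OF that] by (elim conjE)
  have zig: "\<forall>m'. (m, m') \<in> rel M \<longrightarrow> (\<exists>n'. (n, n') \<in> rel N \<and> ((ms, m'), (ns, n')) \<in> B k)"
    if "((ms, m), (ns, n)) \<in> B k" for k ms m ns n
    using bis[unfolded omega_bisim_def, THEN conjunct2, THEN spec, THEN spec, THEN spec, THEN spec,
        THEN spec, THEN mp, OF that] by (elim conjE)
  have zag: "\<forall>n'. (n, n') \<in> rel N \<longrightarrow> (\<exists>m'. (m, m') \<in> rel M \<and> ((ms, m'), (ns, n')) \<in> B k)"
    if "((ms, m), (ns, n)) \<in> B k" for k ms m ns n
    using bis[unfolded omega_bisim_def, THEN conjunct2, THEN spec, THEN spec, THEN spec, THEN spec,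
        THEN spec, THEN mp, OF that] by (elim conjE)
  have 1: "(([m], m), ([n], n)) \<in> B (Suc 0)"
    using ext[OF 0] by simp
  have eq: "m = m' \<longleftrightarrow> n = n'" if "(([m], m'), ([n], n')) \<in> B (Suc 0)" for m' n'
    using wvar[OF that] by simp
  have "(n, n) \<in> rel N" if "(m, m) \<in> rel M"
    using zig[OF 1] eq that by blast
  moreover have "(m, m) \<in> rel M" if "(n, n) \<in> rel N"
    using zag[OF 1] eq that by blast
  ultimately show "fo_true M m (FRel (FVar x) (FVar x)) \<longleftrightarrow> fo_true N n (FRel (FVar x) (FVar x))"
    by (auto simp: fo_true_def)
qed

proposition no_binder_counterexample:
  fixes PROPS :: "'p set" and NOMS :: "'n set" and F :: "feature set" and x :: nat
  assumes inf: "infinite (UNIV :: 'u set)"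
    and F: "Down \<notin> F" "Ex \<notin> F"
  obtains \<phi> :: "('p, 'n) fo" where
    "fo_over PROPS NOMS \<phi>" "fo_fv \<phi> = {x}"
    "omega_bisim_invariant TYPE('u) F PROPS NOMS \<phi>"
    "\<not> (\<exists>\<psi>. hsentence F PROPS NOMS \<psi> \<and> equiv_to_ST_of TYPE('u) PROPS NOMS x \<phi> \<psi>)"
proof (rule that)
  let ?\<phi> = "FRel (FVar x) (FVar x) :: ('p, 'n) fo"
  show "fo_over PROPS NOMS ?\<phi>" "fo_fv ?\<phi> = {x}" by auto
  show "omega_bisim_invariant TYPE('u) F PROPS NOMS ?\<phi>" by (rule FRel_invariant)
  obtain S :: "'u set" where "finite S" "card S = 3"
    using infinite_arbitrarily_large[OF inf] by blast
  then obtain a b c :: 'u where d: "a \<noteq> b" "a \<noteq> c" "b \<noteq> c"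
    by (auto simp: card_3_iff)
  define M :: "('u, 'p, 'n) model" where
    "M = \<lparr>carrier = {a, c}, rel = {(a, a)}, nomi = \<lambda>_. c, val = \<lambda>_. {}\<rparr>"
  define N :: "('u, 'p, 'n) model" where
    "N = \<lparr>carrier = {a, b, c}, rel = {(a, b), (b, a)}, nomi = \<lambda>_. c, val = \<lambda>_. {}\<rparr>"
  have MN: "model_over PROPS NOMS M" "model_over PROPS NOMS N"
    by (auto simp: model_over_def M_def N_def)
  have same: "(hsat M \<nu> a \<psi> \<longleftrightarrow> hsat N \<nu>' a \<psi>) \<and> (hsat M \<nu> a \<psi> \<longleftrightarrow> hsat N \<nu>' b \<psi>) \<and>
      (hsat M \<nu> c \<psi> \<longleftrightarrow> hsat N \<nu>' c \<psi>)"
    if "hform_over F PROPS NOMS \<psi>" "hfv \<psi> = {}" for \<psi> \<nu> \<nu>'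
    using that
  proof (induction \<psi>)
    case (HDia \<psi>)
    then show ?case using d by (auto simp: M_def N_def)
  qed (use F d in \<open>auto simp: M_def N_def\<close>)
  show "\<not> (\<exists>\<psi>. hsentence F PROPS NOMS \<psi> \<and> equiv_to_ST_of TYPE('u) PROPS NOMS x ?\<phi> \<psi>)"
  proof
    assume "\<exists>\<psi>. hsentence F PROPS NOMS \<psi> \<and> equiv_to_ST_of TYPE('u) PROPS NOMS x ?\<phi> \<psi>"
    then obtain \<psi> where s: "hsentence F PROPS NOMS \<psi>"
      and e: "equiv_to_ST_of TYPE('u) PROPS NOMS x ?\<phi> \<psi>" by blast
    have "fo_true M a ?\<phi> \<longleftrightarrow> htrue M a \<psi>" "fo_true N a ?\<phi> \<longleftrightarrow> htrue N a \<psi>"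
      using e MN unfolding equiv_to_ST_of_iff_htrue[OF s] by (auto simp: M_def N_def)
    moreover have "htrue M a \<psi> \<longleftrightarrow> htrue N a \<psi>"
      using same s by (auto simp: htrue_def hsentence_def)
    ultimately show False using d by (auto simp: fo_true_def M_def N_def)
  qed
qed

end

theory Submission
  imports Defs "HOL-Library.Countable_Set"
begin

text \<open>Over a finite signature, finitely many formulas in the variables \<open>0, \<dots>, k - 1\<close> suffice to
  survive \<open>c\<close> moves of the bisimulation game from tuples of length \<open>k\<close>; the binder is needed to answer
  (ext). If \<open>\<phi>\<close> is not definable, then for every \<open>i\<close> there are pointed models that agree on the
  sentences of rank \<open>i\<close> but are separated by \<open>\<phi>\<close>. In their ultraproducts the tuples that agree, for
  each rank \<open>c\<close> separately, at almost all indices form an \<open>\<omega>\<close>-bisimulation, by countable saturation.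
  To stay within the infinite type \<open>'u\<close>, which may be countable, the ultraproducts are cut down to
  countable sets of functions containing witnesses for the moves of the game and for the existential
  subformulas of \<open>\<phi>\<close>; by the theorem of Los \<open>\<phi>\<close> still separates these submodels.\<close>

section \<open>Definable formulas are invariant\<close>

lemma omega_bisimD:
  assumes "omega_bisim F PROPS NOMS M N B" and "((ms, m), (ns, n)) \<in> B k"
  shows "length ms = k" "set ms \<subseteq> carrier M" "m \<in> carrier M"
    and "length ns = k" "set ns \<subseteq> carrier N" "n \<in> carrier N"
    and "p \<in> PROPS \<Longrightarrow> m \<in> val M p \<longleftrightarrow> n \<in> val N p"
    and "j < k \<Longrightarrow> m = ms ! j \<longleftrightarrow> n = ns ! j"
    and "(m, m') \<in> rel M \<Longrightarrow> \<exists>n'. (n, n') \<in> rel N \<and> ((ms, m'), (ns, n')) \<in> B k"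
    and "(n, n') \<in> rel N \<Longrightarrow> \<exists>m'. (m, m') \<in> rel M \<and> ((ms, m'), (ns, n')) \<in> B k"
    and "((ms @ [m], m), (ns @ [n], n)) \<in> B (Suc k)"
    and "Nom \<in> F \<Longrightarrow> s \<in> NOMS \<Longrightarrow> m = nomi M s \<longleftrightarrow> n = nomi N s"
    and "At \<in> F \<Longrightarrow> j < k \<Longrightarrow> ((ms, ms ! j), (ns, ns ! j)) \<in> B k"
    and "At \<in> F \<Longrightarrow> Nom \<in> F \<Longrightarrow> s \<in> NOMS \<Longrightarrow> ((ms, nomi M s), (ns, nomi N s)) \<in> B k"
    and "Ex \<in> F \<Longrightarrow> j < k \<Longrightarrow> u \<in> carrier M \<Longrightarrow>
      \<exists>u'\<in>carrier N. ((ms[j := u], m), (ns[j := u'], n)) \<in> B k"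
    and "Ex \<in> F \<Longrightarrow> j < k \<Longrightarrow> u' \<in> carrier N \<Longrightarrow>
      \<exists>u\<in>carrier M. ((ms[j := u], m), (ns[j := u'], n)) \<in> B k"
proof -
  note bis = assms(1)[unfolded omega_bisim_def, THEN conjunct2, THEN spec, THEN spec, THEN spec,
      THEN spec, THEN spec, THEN mp, OF assms(2)]
  \<comment> \<open>The three tails of the conjunction begin at (prop), (nom) and (atn).\<close>
  note tail1 = bis[THEN conjunct2, THEN conjunct2, THEN conjunct2, THEN conjunct2, THEN conjunct2,
      THEN conjunct2]
  note tail2 = tail1[THEN conjunct2, THEN conjunct2, THEN conjunct2, THEN conjunct2, THEN conjunct2]
  note tail3 = tail2[THEN conjunct2, THEN conjunct2, THEN conjunct2]
  show "length ms = k" "set ms \<subseteq> carrier M" "m \<in> carrier M"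
    "length ns = k" "set ns \<subseteq> carrier N" "n \<in> carrier N"
    by (rule bis[THEN conjunct1] bis[THEN conjunct2, THEN conjunct1]
        bis[THEN conjunct2, THEN conjunct2, THEN conjunct1]
        bis[THEN conjunct2, THEN conjunct2, THEN conjunct2, THEN conjunct1]
        bis[THEN conjunct2, THEN conjunct2, THEN conjunct2, THEN conjunct2, THEN conjunct1]
        bis[THEN conjunct2, THEN conjunct2, THEN conjunct2, THEN conjunct2, THEN conjunct2, THEN conjunct1])+
  show "p \<in> PROPS \<Longrightarrow> m \<in> val M p \<longleftrightarrow> n \<in> val N p"
    using tail1[THEN conjunct1] by blast
  show "j < k \<Longrightarrow> m = ms ! j \<longleftrightarrow> n = ns ! j"
    using tail1[THEN conjunct2, THEN conjunct1] by auto
  show "(m, m') \<in> rel M \<Longrightarrow> \<exists>n'. (n, n') \<in> rel N \<and> ((ms, m'), (ns, n')) \<in> B k"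
    using tail1[THEN conjunct2, THEN conjunct2, THEN conjunct1] by blast
  show "(n, n') \<in> rel N \<Longrightarrow> \<exists>m'. (m, m') \<in> rel M \<and> ((ms, m'), (ns, n')) \<in> B k"
    using tail1[THEN conjunct2, THEN conjunct2, THEN conjunct2, THEN conjunct1] by blast
  show "((ms @ [m], m), (ns @ [n], n)) \<in> B (Suc k)"
    using bis by (elim conjE)
  show "Nom \<in> F \<Longrightarrow> s \<in> NOMS \<Longrightarrow> m = nomi M s \<longleftrightarrow> n = nomi N s"
    using tail2[THEN conjunct1] by blast
  show "At \<in> F \<Longrightarrow> j < k \<Longrightarrow> ((ms, ms ! j), (ns, ns ! j)) \<in> B k"
    using tail2[THEN conjunct2, THEN conjunct2, THEN conjunct1] by blast
  show "At \<in> F \<Longrightarrow> Nom \<in> F \<Longrightarrow> s \<in> NOMS \<Longrightarrow> ((ms, nomi M s), (ns, nomi N s)) \<in> B k"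
    using tail3[THEN conjunct1] by blast
  show "Ex \<in> F \<Longrightarrow> j < k \<Longrightarrow> u \<in> carrier M \<Longrightarrow>
      \<exists>u'\<in>carrier N. ((ms[j := u], m), (ns[j := u'], n)) \<in> B k"
    using tail3[THEN conjunct2] by blast
  show "Ex \<in> F \<Longrightarrow> j < k \<Longrightarrow> u' \<in> carrier N \<Longrightarrow>
      \<exists>u\<in>carrier M. ((ms[j := u], m), (ns[j := u'], n)) \<in> B k"
    using tail3[THEN conjunct2] by blast
qed

text \<open>The map \<open>e\<close> assigns to each free world variable the tuple entry holding its value; a binder
  redirects its variable to the entry appended by (ext).\<close>

lemma omega_bisim_hsat_iff:
  assumes bis: "omega_bisim F PROPS NOMS M N B" and "model_over PROPS NOMS M" "model_over PROPS NOMS N"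
  shows "\<lbrakk>((ms, m), (ns, n)) \<in> B k; hform_over F PROPS NOMS \<psi>;
      \<forall>w\<in>hfv \<psi>. e w < k \<and> \<nu> w = ms ! e w \<and> \<nu>' w = ns ! e w\<rbrakk> \<Longrightarrow>
    hsat M \<nu> m \<psi> \<longleftrightarrow> hsat N \<nu>' n \<psi>"
proof (induction \<psi> arbitrary: ms m ns n k e \<nu> \<nu>')
  case (HProp p)
  then show ?case using omega_bisimD(7)[OF bis HProp.prems(1)] by simp
next
  case (HVar w)
  then show ?case using omega_bisimD(8)[OF bis HVar.prems(1)] by simp
next
  case (HOr \<psi> \<chi>)
  have "hsat M \<nu> m \<psi> \<longleftrightarrow> hsat N \<nu>' n \<psi>" "hsat M \<nu> m \<chi> \<longleftrightarrow> hsat N \<nu>' n \<chi>"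
    by (rule HOr.IH[OF HOr.prems(1)]; use HOr.prems in auto)+
  then show ?case by simp
next
  case (HDia \<psi>)
  have "hsat M \<nu> m' \<psi> \<longleftrightarrow> hsat N \<nu>' n' \<psi>" if "((ms, m'), (ns, n')) \<in> B k" for m' n'
    by (rule HDia.IH[OF that]) (use HDia.prems in auto)
  then show ?case
    using omega_bisimD(9,10)[OF bis HDia.prems(1)] by simp metis
next
  case (HNom s)
  then show ?case using omega_bisimD(12)[OF bis HNom.prems(1)] by simp
next
  case (HDown w \<psi>)
  have len: "length ms = k" "length ns = k"
    using omega_bisimD(1,4)[OF bis HDown.prems(1)] .
  have "hsat M (\<nu>(w := m)) m \<psi> \<longleftrightarrow> hsat N (\<nu>'(w := n)) n \<psi>"
    by (rule HDown.IH[OF omega_bisimD(11)[OF bis HDown.prems(1)], of "e(w := k)"])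
      (use HDown.prems len in \<open>auto simp: nth_append less_Suc_eq\<close>)
  then show ?case by simp
next
  case (HAtVar w \<psi>)
  have "hsat M \<nu> (ms ! e w) \<psi> \<longleftrightarrow> hsat N \<nu>' (ns ! e w) \<psi>"
    by (rule HAtVar.IH[OF omega_bisimD(13)[OF bis HAtVar.prems(1)], of _ e])
      (use HAtVar.prems in auto)
  then show ?case using HAtVar.prems by simp
next
  case (HAtNom s \<psi>)
  have "hsat M \<nu> (nomi M s) \<psi> \<longleftrightarrow> hsat N \<nu>' (nomi N s) \<psi>"
    by (rule HAtNom.IH[OF omega_bisimD(14)[OF bis HAtNom.prems(1)]])
      (use HAtNom.prems in auto)
  then show ?case by simp
next
  case (HEx w \<psi>)
  \<comment> \<open>(ex) only overwrites existing entries, and for \<open>k = 0\<close> there is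
    none. So (ext) first appends a slot at index \<open>k\<close>, and (ex) is played on that slot;
    the entries below \<open>k\<close>, which hold the other free variables, stay untouched.\<close>
  note ext = omega_bisimD(11)[OF bis HEx.prems(1)]
  have len: "length ms = k" "length ns = k"
    using omega_bisimD(1,4)[OF bis HEx.prems(1)] .
  have *: "hsat M (\<nu>(w := u)) m \<psi> \<longleftrightarrow> hsat N (\<nu>'(w := u')) n \<psi>"
    if "(((ms @ [m])[k := u], m), ((ns @ [n])[k := u'], n)) \<in> B (Suc k)" for u u'
    by (rule HEx.IH[OF that, of "e(w := k)"])
      (use HEx.prems len in \<open>auto simp: nth_append nth_list_update less_Suc_eq\<close>)
  have "Ex \<in> F" using HEx.prems(2) by simp
  then show ?case
    using omega_bisimD(15,16)[OF bis ext, of k] * by simp metis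
next
  case (HNeg \<psi>)
  have "hsat M \<nu> m \<psi> \<longleftrightarrow> hsat N \<nu>' n \<psi>"
    by (rule HNeg.IH[OF HNeg.prems(1), of e]) (use HNeg.prems in auto)
  then show ?case by simp
qed auto

lemma hsentence_omega_bisim_invariant:
  assumes bis: "omega_bisim F PROPS NOMS M N B" "model_over PROPS NOMS M" "model_over PROPS NOMS N"
    and "(([], m), ([], n)) \<in> B 0" "hsentence F PROPS NOMS \<psi>"
  shows "htrue M m \<psi> \<longleftrightarrow> htrue N n \<psi>"
  using omega_bisim_hsat_iff[OF bis assms(4)] assms(5) by (simp add: htrue_def hsentence_def)


section \<open>Finitely many formulas of bounded rank\<close>

definition HAnd :: "('p, 'n) hform \<Rightarrow> ('p, 'n) hform \<Rightarrow> ('p, 'n) hform" where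
  "HAnd \<psi> \<chi> = HNeg (HOr (HNeg \<psi>) (HNeg \<chi>))"

lemma HAnd_simps [simp]:
  "hsat M \<nu> m (HAnd \<psi> \<chi>) \<longleftrightarrow> hsat M \<nu> m \<psi> \<and> hsat M \<nu> m \<chi>"
  "hfv (HAnd \<psi> \<chi>) = hfv \<psi> \<union> hfv \<chi>"
  "hform_over F PROPS NOMS (HAnd \<psi> \<chi>) \<longleftrightarrow> hform_over F PROPS NOMS \<psi> \<and> hform_over F PROPS NOMS \<chi>"
  by (auto simp: HAnd_def)

text \<open>Treats both binders uniformly: in the absence of \<open>Down\<close>, the conjunct
  \<open>HVar w\<close> pins the quantified world to the current one. Since the quantifier ranges
  over the carrier, \<open>hsat_down\<close> asks that the current world lie there.\<close>

definition down :: "feature set \<Rightarrow> nat \<Rightarrow> ('p, 'n) hform \<Rightarrow> ('p, 'n) hform" where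
  "down F w \<psi> = (if Down \<in> F then HDown w \<psi> else HEx w (HAnd (HVar w) \<psi>))"

lemma hsat_down [simp]: "m \<in> carrier M \<Longrightarrow> hsat M \<nu> m (down F w \<psi>) \<longleftrightarrow> hsat M (\<nu>(w := m)) m \<psi>"
  by (auto simp: down_def)

lemma hfv_down [simp]: "hfv (down F w \<psi>) = hfv \<psi> - {w}"
  by (auto simp: down_def)

lemma hform_over_down [simp]:
  "Down \<in> F \<or> Ex \<in> F \<Longrightarrow> hform_over F PROPS NOMS (down F w \<psi>) \<longleftrightarrow> hform_over F PROPS NOMS \<psi>"
  by (auto simp: down_def)

text \<open>The complete Boolean types over a finite list, one conjunction for each choice of signs,
  with \<open>HNeg HBot\<close> as the empty conjunction. Finiteness makes each type a single
  formula.\<close>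

primrec types :: "('p, 'n) hform list \<Rightarrow> ('p, 'n) hform list" where
  "types [] = [HNeg HBot]"
| "types (\<chi> # \<Phi>) = map (HAnd \<chi>) (types \<Phi>) @ map (HAnd (HNeg \<chi>)) (types \<Phi>)"

lemma types_realised: "\<exists>\<tau>\<in>set (types \<Phi>). hsat M \<nu> m \<tau>"
proof (induction \<Phi>)
  case (Cons \<chi> \<Phi>)
  then obtain \<tau> where "\<tau> \<in> set (types \<Phi>)" "hsat M \<nu> m \<tau>" by blast
  then show ?case by (cases "hsat M \<nu> m \<chi>") (auto simp: bex_Un)
qed simp

text \<open>One of the two signs of \<open>\<chi>\<close> is a conjunct of \<open>\<tau>\<close>, so
  a shared type decides every formula of \<open>\<Phi>\<close> in the same way on both
  sides.\<close>

lemma types_agree: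
  "\<tau> \<in> set (types \<Phi>) \<Longrightarrow> hsat M \<nu> m \<tau> \<Longrightarrow> hsat N \<nu>' n \<tau> \<Longrightarrow> \<chi> \<in> set \<Phi> \<Longrightarrow>
    hsat M \<nu> m \<chi> \<longleftrightarrow> hsat N \<nu>' n \<chi>"
  by (induction \<Phi> arbitrary: \<tau>) auto

lemma hfv_types: "\<tau> \<in> set (types \<Phi>) \<Longrightarrow> hfv \<tau> \<subseteq> (\<Union>\<chi>\<in>set \<Phi>. hfv \<chi>)"
proof (induction \<Phi> arbitrary: \<tau>)
  case (Cons \<chi> \<Phi>)
  then obtain \<tau>' where "\<tau>' \<in> set (types \<Phi>)" "hfv \<tau> = hfv \<chi> \<union> hfv \<tau>'" by auto
  then show ?case using Cons.IH by auto
qed simp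

lemma hform_over_types:
  "\<tau> \<in> set (types \<Phi>) \<Longrightarrow> \<forall>\<chi>\<in>set \<Phi>. hform_over F PROPS NOMS \<chi> \<Longrightarrow> hform_over F PROPS NOMS \<tau>"
  by (induction \<Phi> arbitrary: \<tau>) auto

text \<open>Each rank pays for one move of the bisimulation game; \<open>k\<close> is the length of the current tuples,
  which grows when (ext) is played.\<close>

primrec ranked :: "feature set \<Rightarrow> 'p list \<Rightarrow> 'n list \<Rightarrow> nat \<Rightarrow> nat \<Rightarrow> ('p, 'n) hform list" where
  "ranked F ps ns 0 = (\<lambda>k. map HProp ps @ map HVar [0..<k] @ (if Nom \<in> F then map HNom ns else []))"
| "ranked F ps ns (Suc c) = (\<lambda>k.
     ranked F ps ns c k @
     map HDia (types (ranked F ps ns c k)) @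
     map (down F k) (ranked F ps ns c (Suc k)) @
     concat (map (\<lambda>j. map (down F j) (ranked F ps ns c k)) [0..<k]) @
     (if At \<in> F then concat (map (\<lambda>j. map (HAtVar j) (ranked F ps ns c k)) [0..<k]) else []) @
     (if At \<in> F \<and> Nom \<in> F then concat (map (\<lambda>s. map (HAtNom s) (ranked F ps ns c k)) ns) else []) @
     (if Ex \<in> F then concat (map (\<lambda>j. map (HEx j) (types (ranked F ps ns c k))) [0..<k]) else []))"

lemma ranked_mono: "c \<le> d \<Longrightarrow> set (ranked F ps ns c k) \<subseteq> set (ranked F ps ns d k)"
  by (induction rule: dec_induct) auto

lemma hfv_ranked: "\<chi> \<in> set (ranked F ps ns c k) \<Longrightarrow> hfv \<chi> \<subseteq> {..<k}"
proof (induction c arbitrary: k \<chi>)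
  case 0
  then show ?case by (auto split: if_splits)
next
  case (Suc c)
  have types: "hfv \<tau> \<subseteq> {..<k}" if "\<tau> \<in> set (types (ranked F ps ns c k))" for \<tau>
    using hfv_types[OF that] Suc.IH by blast
  \<comment> \<open>Formulas for tuples of length \<open>Suc k\<close> enter the list for length
    \<open>k\<close> only under \<open>down F k\<close>, which binds the extra variable.\<close>
  have "hfv \<chi>' - {k} \<subseteq> {..<k}" if "\<chi>' \<in> set (ranked F ps ns c (Suc k))" for \<chi>'
    using Suc.IH[OF that] by (auto simp: less_Suc_eq)
  then show ?case
    using Suc.prems by (auto split: if_splits dest!: types Suc.IH)
qed

lemma hform_over_ranked:
  assumes "Down \<in> F \<or> Ex \<in> F" "set ps \<subseteq> PROPS" "set ns \<subseteq> NOMS"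
  shows "\<chi> \<in> set (ranked F ps ns c k) \<Longrightarrow> hform_over F PROPS NOMS \<chi>"
proof (induction c arbitrary: k \<chi>)
  case 0
  then show ?case using assms by (auto split: if_splits)
next
  case (Suc c)
  have "hform_over F PROPS NOMS \<tau>" if "\<tau> \<in> set (types (ranked F ps ns c k))" for \<tau>
    using hform_over_types[OF that] Suc.IH by blast
  then show ?case
    using Suc assms by (auto split: if_splits)
qed

section \<open>Agreement of tuples up to a rank, and the moves it survives\<close>

definition tuple_asg :: "'u list \<Rightarrow> nat \<Rightarrow> 'u" where
  "tuple_asg us w = (if w < length us then us ! w else undefined)"

text \<open>An equality of functions, because both sides take the same value
  \<open>undefined\<close> beyond the new entry.\<close>

lemma tuple_asg_append: "tuple_asg (us @ [u]) = (tuple_asg us)(length us := u)"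
  by (auto simp: tuple_asg_def fun_eq_iff nth_append)

lemma tuple_asg_update: "j < length us \<Longrightarrow> tuple_asg (us[j := u]) = (tuple_asg us)(j := u)"
  by (auto simp: tuple_asg_def fun_eq_iff)

definition agree :: "feature set \<Rightarrow> 'p list \<Rightarrow> 'n list \<Rightarrow> nat \<Rightarrow> ('u, 'p, 'n) model \<Rightarrow> 'u list \<Rightarrow> 'u \<Rightarrow>
    ('u, 'p, 'n) model \<Rightarrow> 'u list \<Rightarrow> 'u \<Rightarrow> bool" where
  "agree F ps ns c M us u N vs v \<longleftrightarrow> length us = length vs \<and>
    (\<forall>\<chi>\<in>set (ranked F ps ns c (length us)). hsat M (tuple_asg us) u \<chi> \<longleftrightarrow> hsat N (tuple_asg vs) v \<chi>)"

lemma agree_sym: "agree F ps ns c M us u N vs v \<longleftrightarrow> agree F ps ns c N vs v M us u"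
  by (auto simp: agree_def)

lemma agree_mono: "agree F ps ns d M us u N vs v \<Longrightarrow> c \<le> d \<Longrightarrow> agree F ps ns c M us u N vs v"
  using ranked_mono by (fastforce simp: agree_def)

lemma agree_atoms:
  assumes "agree F ps ns c M us u N vs v"
  shows "length us = length vs"
    and "p \<in> set ps \<Longrightarrow> u \<in> val M p \<longleftrightarrow> v \<in> val N p"
    and "j < length us \<Longrightarrow> us ! j = u \<longleftrightarrow> vs ! j = v"
    and "Nom \<in> F \<Longrightarrow> s \<in> set ns \<Longrightarrow> u = nomi M s \<longleftrightarrow> v = nomi N s"
proof -
  have *: "length us = length vs"
    "\<forall>\<chi>\<in>set (ranked F ps ns 0 (length us)). hsat M (tuple_asg us) u \<chi> \<longleftrightarrow> hsat N (tuple_asg vs) v \<chi>"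
    using agree_mono[OF assms, of 0] by (simp_all add: agree_def)
  show "length us = length vs" by fact
  show "p \<in> set ps \<Longrightarrow> u \<in> val M p \<longleftrightarrow> v \<in> val N p"
    using *(2)[THEN bspec, of "HProp p"] by simp
  show "j < length us \<Longrightarrow> us ! j = u \<longleftrightarrow> vs ! j = v"
    using *(2)[THEN bspec, of "HVar j"] *(1) by (auto simp: tuple_asg_def)
  show "Nom \<in> F \<Longrightarrow> s \<in> set ns \<Longrightarrow> u = nomi M s \<longleftrightarrow> v = nomi N s"
    using *(2)[THEN bspec, of "HNom s"] by simp
qed

text \<open>Each move has its block of formulas in rank \<open>Suc c\<close>. The forced moves are
  tested by prefixing a formula of rank \<open>c\<close> with the matching operator. A (forth) or
  (ex) move needs one reply that is right for all formulas of rank \<open>c\<close> at once, so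
  \<open>HDia\<close> and \<open>HEx\<close> are applied to the complete type of the position
  reached.\<close>

lemma agree_moves:
  assumes "agree F ps ns (Suc c) M us u N vs v"
  shows "u \<in> carrier M \<Longrightarrow> v \<in> carrier N \<Longrightarrow> agree F ps ns c M (us @ [u]) u N (vs @ [v]) v"
    and "u \<in> carrier M \<Longrightarrow> v \<in> carrier N \<Longrightarrow> j < length us \<Longrightarrow>
      agree F ps ns c M (us[j := u]) u N (vs[j := v]) v"
    and "At \<in> F \<Longrightarrow> j < length us \<Longrightarrow> agree F ps ns c M us (us ! j) N vs (vs ! j)"
    and "At \<in> F \<Longrightarrow> Nom \<in> F \<Longrightarrow> s \<in> set ns \<Longrightarrow> agree F ps ns c M us (nomi M s) N vs (nomi N s)"
    and "(u, u') \<in> rel M \<Longrightarrow> \<exists>v'. (v, v') \<in> rel N \<and> agree F ps ns c M us u' N vs v'"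
    and "Ex \<in> F \<Longrightarrow> j < length us \<Longrightarrow> w \<in> carrier M \<Longrightarrow>
      \<exists>w'\<in>carrier N. agree F ps ns c M (us[j := w]) u N (vs[j := w']) v"
proof -
  have len: "length us = length vs"
    and *: "\<And>\<chi>. \<chi> \<in> set (ranked F ps ns (Suc c) (length us)) \<Longrightarrow>
      hsat M (tuple_asg us) u \<chi> \<longleftrightarrow> hsat N (tuple_asg vs) v \<chi>"
    using assms by (auto simp: agree_def)
  let ?R = "ranked F ps ns c (length us)"
  show "agree F ps ns c M (us @ [u]) u N (vs @ [v]) v" if "u \<in> carrier M" "v \<in> carrier N"
    unfolding agree_def tuple_asg_append
  proof (intro conjI ballI)
    fix \<chi> assume "\<chi> \<in> set (ranked F ps ns c (length (us @ [u])))"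
    then show "hsat M ((tuple_asg us)(length us := u)) u \<chi> \<longleftrightarrow> hsat N ((tuple_asg vs)(length vs := v)) v \<chi>"
      using *[of "down F (length us) \<chi>"] that len by simp
  qed (use len in simp)
  show "agree F ps ns c M (us[j := u]) u N (vs[j := v]) v"
    if "u \<in> carrier M" "v \<in> carrier N" "j < length us"
    unfolding agree_def
  proof (intro conjI ballI)
    fix \<chi> assume "\<chi> \<in> set (ranked F ps ns c (length (us[j := u])))"
    then have "\<chi> \<in> set ?R" by simp
    then have "hsat M (tuple_asg us) u (down F j \<chi>) \<longleftrightarrow> hsat N (tuple_asg vs) v (down F j \<chi>)"
      using that(3) by (intro *) auto
    then show "hsat M (tuple_asg (us[j := u])) u \<chi> \<longleftrightarrow> hsat N (tuple_asg (vs[j := v])) v \<chi>"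
      using that len by (simp add: tuple_asg_update)
  qed (use len in simp)
  show "agree F ps ns c M us (us ! j) N vs (vs ! j)" if "At \<in> F" "j < length us"
    unfolding agree_def
  proof (intro conjI ballI)
    fix \<chi> assume "\<chi> \<in> set ?R"
    then have "hsat M (tuple_asg us) u (HAtVar j \<chi>) \<longleftrightarrow> hsat N (tuple_asg vs) v (HAtVar j \<chi>)"
      using that by (intro *) auto
    then show "hsat M (tuple_asg us) (us ! j) \<chi> \<longleftrightarrow> hsat N (tuple_asg vs) (vs ! j) \<chi>"
      using that len by (simp add: tuple_asg_def)
  qed (use len in simp)
  show "agree F ps ns c M us (nomi M s) N vs (nomi N s)" if "At \<in> F" "Nom \<in> F" "s \<in> set ns"
    unfolding agree_def
  proof (intro conjI ballI)
    fix \<chi> assume "\<chi> \<in> set ?R"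
    then have "hsat M (tuple_asg us) u (HAtNom s \<chi>) \<longleftrightarrow> hsat N (tuple_asg vs) v (HAtNom s \<chi>)"
      using that by (intro *) auto
    then show "hsat M (tuple_asg us) (nomi M s) \<chi> \<longleftrightarrow> hsat N (tuple_asg vs) (nomi N s) \<chi>"
      by simp
  qed (use len in simp)
  show "\<exists>v'. (v, v') \<in> rel N \<and> agree F ps ns c M us u' N vs v'" if uu': "(u, u') \<in> rel M"
  proof -
    obtain \<tau> where \<tau>: "\<tau> \<in> set (types ?R)" "hsat M (tuple_asg us) u' \<tau>"
      using types_realised[of _ M] by meson
    have "hsat M (tuple_asg us) u (HDia \<tau>) \<longleftrightarrow> hsat N (tuple_asg vs) v (HDia \<tau>)"
      using \<tau>(1) by (intro *) auto
    then obtain v' where "(v, v') \<in> rel N" "hsat N (tuple_asg vs) v' \<tau>"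
      using uu' \<tau>(2) by auto
    then show ?thesis
      using types_agree[OF \<tau>, of N "tuple_asg vs" v'] len by (auto simp: agree_def)
  qed
  show "\<exists>w'\<in>carrier N. agree F ps ns c M (us[j := w]) u N (vs[j := w']) v"
    if Ex: "Ex \<in> F" "j < length us" "w \<in> carrier M"
  proof -
    obtain \<tau> where \<tau>: "\<tau> \<in> set (types ?R)" "hsat M (tuple_asg (us[j := w])) u \<tau>"
      using types_realised[of _ M] by meson
    have "hsat M (tuple_asg us) u (HEx j \<tau>) \<longleftrightarrow> hsat N (tuple_asg vs) v (HEx j \<tau>)"
      using \<tau>(1) Ex by (intro *) auto
    then obtain w' where "w' \<in> carrier N" "hsat N (tuple_asg (vs[j := w'])) v \<tau>"
      using Ex \<tau>(2) len by (auto simp: tuple_asg_update)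
    then show ?thesis
      using types_agree[OF \<tau>, of N "tuple_asg (vs[j := w'])" v] len by (auto simp: agree_def)
  qed
qed

section \<open>Definability by a disjunction of types\<close>

definition hdisj :: "('p, 'n) hform list \<Rightarrow> ('p, 'n) hform" where
  "hdisj \<Phi> = foldr HOr \<Phi> HBot"

lemma hdisj_simps [simp]:
  "hsat M \<nu> m (hdisj \<Phi>) \<longleftrightarrow> (\<exists>\<chi>\<in>set \<Phi>. hsat M \<nu> m \<chi>)"
  "hfv (hdisj \<Phi>) = (\<Union>\<chi>\<in>set \<Phi>. hfv \<chi>)"
  "hform_over F PROPS NOMS (hdisj \<Phi>) \<longleftrightarrow> (\<forall>\<chi>\<in>set \<Phi>. hform_over F PROPS NOMS \<chi>)"
  by (induction \<Phi>) (auto simp: hdisj_def)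

text \<open>If no such pair existed for rank \<open>c\<close>, then \<open>\<phi>\<close> would be
  equivalent to the disjunction of those types over the rank \<open>c\<close> sentences that are
  realised at some world where \<open>\<phi>\<close> holds.\<close>

lemma definable_or_agreeing_counterexample:
  fixes \<phi> :: "('p, 'n) fo"
  assumes F: "Down \<in> F \<or> Ex \<in> F" and "set ps \<subseteq> PROPS" "set ns \<subseteq> NOMS"
    and undef: "\<nexists>\<psi>. hsentence F PROPS NOMS \<psi> \<and> equiv_to_ST_of TYPE('u) PROPS NOMS x \<phi> \<psi>"
  obtains M N :: "('u, 'p, 'n) model" and m n where
    "model_over PROPS NOMS M" "m \<in> carrier M" "model_over PROPS NOMS N" "n \<in> carrier N"
    "agree F ps ns c M [] m N [] n" "fo_true M m \<phi>" "\<not> fo_true N n \<phi>"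
proof (rule ccontr)
  note ce = that
  assume no: "\<not> thesis"
  define T where "T = types (ranked F ps ns c 0)"
  define real where "real \<tau> \<longleftrightarrow> (\<exists>(M :: ('u, 'p, 'n) model) m. model_over PROPS NOMS M \<and> m \<in> carrier M \<and>
    fo_true M m \<phi> \<and> hsat M (tuple_asg []) m \<tau>)" for \<tau>
  define \<psi> where "\<psi> = hdisj (filter real T)"
  have fv: "hfv \<tau> = {}" if "\<tau> \<in> set T" for \<tau>
    using hfv_types[OF that[unfolded T_def]] hfv_ranked[of _ F ps ns c 0] by blast
  have "hform_over F PROPS NOMS \<tau>" if "\<tau> \<in> set T" for \<tau>
    using hform_over_types[OF that[unfolded T_def]] hform_over_ranked[OF assms(1-3)] by blast
  then have sent: "hsentence F PROPS NOMS \<psi>"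
    using fv by (auto simp: hsentence_def \<psi>_def)
  \<comment> \<open>Types over tuples of length 0 are sentences, so the constant assignment of
    \<open>htrue\<close> may be exchanged for \<open>tuple_asg []\<close>.\<close>
  have asg: "hsat M (\<lambda>_. m) m \<tau> \<longleftrightarrow> hsat M (tuple_asg []) m \<tau>"
    if "\<tau> \<in> set T" for \<tau> and M :: "('u, 'p, 'n) model" and m
    by (rule hsat_cong) (simp add: fv[OF that])
  have "fo_true M m \<phi> \<longleftrightarrow> htrue M m \<psi>" if M: "model_over PROPS NOMS M" "m \<in> carrier M"
    for M :: "('u, 'p, 'n) model" and m
  proof
    assume "fo_true M m \<phi>"
    moreover obtain \<tau> where "\<tau> \<in> set T" "hsat M (tuple_asg []) m \<tau>"
      unfolding T_def using types_realised[of _ M] by meson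
    ultimately show "htrue M m \<psi>"
      using M asg by (auto simp: htrue_def \<psi>_def real_def)
  next
    assume "htrue M m \<psi>"
    then obtain \<tau> and M' :: "('u, 'p, 'n) model" and m' where \<tau>: "\<tau> \<in> set T" "hsat M (tuple_asg []) m \<tau>"
      and M': "model_over PROPS NOMS M'" "m' \<in> carrier M'" "fo_true M' m' \<phi>" "hsat M' (tuple_asg []) m' \<tau>"
      using asg by (auto simp: htrue_def \<psi>_def real_def)
    \<comment> \<open>Both worlds satisfy \<open>\<tau>\<close>. If \<open>\<phi>\<close> failed at
      \<open>m\<close>, they would form the pair excluded by \<open>no\<close>.\<close>
    have "agree F ps ns c M' [] m' M [] m"
      using types_agree[OF \<tau>(1)[unfolded T_def] M'(4) \<tau>(2)] by (simp add: agree_def)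
    then show "fo_true M m \<phi>"
      using no ce[OF M'(1,2) M _ M'(3)] by blast
  qed
  then show False
    using undef sent equiv_to_ST_of_iff_htrue[OF sent] by blast
qed


section \<open>Countable subproducts of ultraproducts\<close>

text \<open>Zorn's lemma for the reversed order: finer filters are smaller, so the filter sought is
  minimal among the proper filters below \<open>G\<close>. Minimality decides each \<open>P\<close>,
  since adding \<open>P\<close> to the filter cannot refine it properly.\<close>

lemma ultrafilter_exists:
  assumes "G \<noteq> bot"
  obtains U where "U \<noteq> bot" "U \<le> G" "\<And>P. eventually P U \<or> eventually (\<lambda>i. \<not> P i) U"
proof -
  define A where "A = {U. U \<noteq> bot \<and> U \<le> G}"
  have "\<exists>U\<in>A. \<forall>V\<in>A. U \<ge> V \<longrightarrow> V = U"
  proof (rule predicate_Zorn)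
    show "partial_order_on A (relation_of (\<ge>) A)"
      by (auto simp: partial_order_on_def preorder_on_def refl_on_def trans_def antisym_def relation_of_def)
  next
    fix C assume C: "C \<in> Chains (relation_of (\<ge>) A)"
    then have CA: "C \<subseteq> A" and lin: "\<And>U V. U \<in> C \<Longrightarrow> V \<in> C \<Longrightarrow> U \<le> V \<or> V \<le> U"
      by (auto simp: Chains_def relation_of_def)
    show "\<exists>U\<in>A. \<forall>V\<in>C. V \<ge> U"
    proof (cases "C = {}")
      case True
      then show ?thesis using assms by (auto simp: A_def)
    next
      case False
      have "\<exists>W\<in>C. W \<le> inf U V" if "U \<in> C" "V \<in> C" for U V
        using lin[OF that] that by (metis inf.absorb1 inf.absorb2 order_refl)
      \<comment> \<open>A chain is directed, so an event is large for \<open>Inf C\<close> only if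
        it is large for some member; each member is proper.\<close>
      then have "Inf C \<noteq> bot"
        using CA False by (subst trivial_limit_def, subst eventually_Inf_base) (auto simp: A_def trivial_limit_def)
      moreover have "Inf C \<le> G"
        using CA False by (auto simp: A_def intro: Inf_lower2)
      ultimately show ?thesis by (auto simp: A_def intro: Inf_lower)
    qed
  qed
  then obtain U where U: "U \<noteq> bot" "U \<le> G" and max: "\<And>V. V \<noteq> bot \<Longrightarrow> V \<le> U \<Longrightarrow> V = U"
    unfolding A_def using order_trans by blast
  have "eventually P U" if "\<not> eventually (\<lambda>i. \<not> P i) U" for P
  proof -
    \<comment> \<open>The filter with \<open>P\<close> added is improper only if the negation of
      \<open>P\<close> is already large.\<close>
    have "inf U (principal {i. P i}) \<noteq> bot"
      using that by (simp add: trivial_limit_def eventually_inf_principal)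
    then have "inf U (principal {i. P i}) = U" by (rule max) simp
    moreover have "eventually P (inf U (principal {i. P i}))"
      by (simp add: eventually_inf_principal)
    ultimately show ?thesis by simp
  qed
  then show ?thesis using that U by blast
qed

section \<open>Simultaneous countable closure of two sets\<close>

lemma set_subset_mono:
  assumes "mono (A :: nat \<Rightarrow> _)" "set xs \<subseteq> (\<Union>n. A n)"
  shows "\<exists>n. set xs \<subseteq> A n"
  using assms(2)
proof (induction xs)
  case (Cons x xs)
  then obtain n k where "x \<in> A n" "set xs \<subseteq> A k" by auto
  then have "set (x # xs) \<subseteq> A (max n k)"
    using monoD[OF assms(1), of n "max n k"] monoD[OF assms(1), of k "max n k"] by auto
  then show ?case ..
qed simp

text \<open>The operations read lists from both sides, so both sets grow together in stages.
  Arguments are finite lists, hence \<open>\<omega>\<close> stages suffice, and countably many lists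
  with countable values keep each stage countable.\<close>

lemma countable_closure_pair:
  fixes S :: "'a list \<Rightarrow> 'b list \<Rightarrow> 'a set" and T :: "'a list \<Rightarrow> 'b list \<Rightarrow> 'b set"
  assumes "countable X0" "countable Y0" "\<And>xs ys. countable (S xs ys)" "\<And>xs ys. countable (T xs ys)"
    and "X0 \<subseteq> PX" "Y0 \<subseteq> PY"
    and "\<And>xs ys. set xs \<subseteq> PX \<Longrightarrow> set ys \<subseteq> PY \<Longrightarrow> S xs ys \<subseteq> PX \<and> T xs ys \<subseteq> PY"
  obtains X Y where "countable X" "countable Y" "X0 \<subseteq> X" "X \<subseteq> PX" "Y0 \<subseteq> Y" "Y \<subseteq> PY"
    "\<And>xs ys. set xs \<subseteq> X \<Longrightarrow> set ys \<subseteq> Y \<Longrightarrow> S xs ys \<subseteq> X \<and> T xs ys \<subseteq> Y"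
proof -
  define step where "step = (\<lambda>(X, Y).
    (X \<union> (\<Union>xs\<in>lists X. \<Union>ys\<in>lists Y. S xs ys), Y \<union> (\<Union>xs\<in>lists X. \<Union>ys\<in>lists Y. T xs ys)))"
  define Z where "Z n = (step ^^ n) (X0, Y0)" for n
  define X where "X n = fst (Z n)" for n
  define Y where "Y n = snd (Z n)" for n
  have X0: "X 0 = X0" and Y0: "Y 0 = Y0" by (simp_all add: X_def Y_def Z_def)
  have XS: "X (Suc n) = X n \<union> (\<Union>xs\<in>lists (X n). \<Union>ys\<in>lists (Y n). S xs ys)"
    and YS: "Y (Suc n) = Y n \<union> (\<Union>xs\<in>lists (X n). \<Union>ys\<in>lists (Y n). T xs ys)" for n
    by (simp_all add: X_def Y_def Z_def step_def split: prod.splits)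
  have cnt: "countable (X n) \<and> countable (Y n)" for n
  proof (induction n)
    case (Suc n)
    then show ?case unfolding XS YS
      by (intro conjI countable_Un countable_UN countable_lists assms(3,4)) auto
  qed (simp add: X0 Y0 assms)
  have P: "X n \<subseteq> PX \<and> Y n \<subseteq> PY" for n
  proof (induction n)
    case (Suc n)
    then have "S xs ys \<subseteq> PX \<and> T xs ys \<subseteq> PY" if "xs \<in> lists (X n)" "ys \<in> lists (Y n)" for xs ys
      using that by (intro assms) (auto simp: in_lists_conv_set)
    then have "(\<Union>xs\<in>lists (X n). \<Union>ys\<in>lists (Y n). S xs ys) \<subseteq> PX"
      "(\<Union>xs\<in>lists (X n). \<Union>ys\<in>lists (Y n). T xs ys) \<subseteq> PY"
      by (intro UN_least; simp)+
    then show ?case using Suc unfolding XS YS by (meson Un_least)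
  qed (simp add: X0 Y0 assms)
  have incX: "mono X" by (simp add: mono_iff_le_Suc XS)
  have incY: "mono Y" by (simp add: mono_iff_le_Suc YS)
  show ?thesis
  proof (rule that[of "\<Union>n. X n" "\<Union>n. Y n"])
    show "countable (\<Union>n. X n)" "countable (\<Union>n. Y n)" using cnt by auto
    show "X0 \<subseteq> (\<Union>n. X n)" "Y0 \<subseteq> (\<Union>n. Y n)" using X0 Y0 by blast+
    show "(\<Union>n. X n) \<subseteq> PX" "(\<Union>n. Y n) \<subseteq> PY" using P by blast+
    fix xs ys assume "set xs \<subseteq> (\<Union>n. X n)" "set ys \<subseteq> (\<Union>n. Y n)"
    then obtain n k where "set xs \<subseteq> X n" "set ys \<subseteq> Y k"
      using set_subset_mono[OF incX] set_subset_mono[OF incY] by metis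
    \<comment> \<open>The two lists may appear at different stages; their values are added one stage
      after the later one.\<close>
    moreover have "X n \<subseteq> X (max n k)" "Y k \<subseteq> Y (max n k)"
      using incX incY by (simp_all add: monoD)
    ultimately have *: "xs \<in> lists (X (max n k))" "ys \<in> lists (Y (max n k))"
      by (auto simp: in_lists_conv_set)
    then have "S xs ys \<subseteq> X (Suc (max n k))" "T xs ys \<subseteq> Y (Suc (max n k))"
      unfolding XS YS by blast+
    then show "S xs ys \<subseteq> (\<Union>n. X n) \<and> T xs ys \<subseteq> (\<Union>n. Y n)" by blast
  qed
qed

text \<open>\<open>pick A P i\<close> realises at index \<open>i\<close> the strongest satisfiable condition \<open>P i c\<close> with \<open>c \<le> i\<close>.
  For each \<open>c\<close> it is thus a witness at almost all indices where one exists, which is all the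
  saturation that is needed below.\<close>

definition pick :: "(nat \<Rightarrow> ('u, 'p, 'n) model) \<Rightarrow> (nat \<Rightarrow> nat \<Rightarrow> 'u \<Rightarrow> bool) \<Rightarrow> nat \<Rightarrow> 'u" where
  "pick A P i = (SOME u. u \<in> carrier (A i) \<and> (\<forall>c\<le>i. (\<exists>v\<in>carrier (A i). P i c v) \<longrightarrow> P i c u))"

text \<open>The conditions grow stronger with \<open>c\<close>, so a witness of the last satisfiable
  one up to the bound serves all earlier ones; induction on the bound finds it. If none is
  satisfiable, the non-empty carrier supplies a value.\<close>

lemma pick:
  assumes "carrier (A i) \<noteq> {}" and anti: "\<And>c d u. c \<le> d \<Longrightarrow> P i d u \<Longrightarrow> P i c u"
  shows "pick A P i \<in> carrier (A i)"
    and "c \<le> i \<Longrightarrow> v \<in> carrier (A i) \<Longrightarrow> P i c v \<Longrightarrow> P i c (pick A P i)"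
proof -
  have "\<exists>u. u \<in> carrier (A i) \<and> (\<forall>c\<le>n. (\<exists>v\<in>carrier (A i). P i c v) \<longrightarrow> P i c u)" for n
  proof (induction n)
    case 0
    then show ?case using assms(1) by auto
  next
    case (Suc n)
    show ?case
    proof (cases "\<exists>v\<in>carrier (A i). P i (Suc n) v")
      case True
      then show ?thesis using anti by blast
    next
      case False
      then show ?thesis using Suc by (metis le_Suc_eq)
    qed
  qed
  then have "pick A P i \<in> carrier (A i) \<and> (\<forall>c\<le>i. (\<exists>v\<in>carrier (A i). P i c v) \<longrightarrow> P i c (pick A P i))"
    unfolding pick_def by (rule someI_ex)
  then show "pick A P i \<in> carrier (A i)"
    "c \<le> i \<Longrightarrow> v \<in> carrier (A i) \<Longrightarrow> P i c v \<Longrightarrow> P i c (pick A P i)" by blast+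
qed

text \<open>Classes are formed inside the countable set \<open>C\<close>, so there are countably
  many. They are numbered, and the numbers are embedded in the infinite type \<open>'u\<close>,
  which thus can house the carrier of the subproduct.\<close>

lemma quotient_embedding:
  assumes inf: "infinite (UNIV :: 'u set)" and C: "countable (C :: (nat \<Rightarrow> 'u) set)"
  obtains q :: "(nat \<Rightarrow> 'u) \<Rightarrow> 'u" where
    "\<And>f g. f \<in> C \<Longrightarrow> g \<in> C \<Longrightarrow> q f = q g \<longleftrightarrow> eventually (\<lambda>i. f i = g i) U"
proof -
  obtain h :: "nat \<Rightarrow> 'u" where h: "inj h"
    using infinite_countable_subset[OF inf] by blast
  define cls where "cls f = {g\<in>C. eventually (\<lambda>i. f i = g i) U}" for f
  define q where "q f = h (to_nat_on (cls ` C) (cls f))" for f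
  have "q f = q g \<longleftrightarrow> eventually (\<lambda>i. f i = g i) U" if fg: "f \<in> C" "g \<in> C" for f g
  proof -
    have "q f = q g \<longleftrightarrow> cls f = cls g"
      unfolding q_def using h C fg by (simp add: inj_eq)
    also have "\<dots> \<longleftrightarrow> eventually (\<lambda>i. f i = g i) U"
    proof
      assume "cls f = cls g"
      moreover have "g \<in> cls g" using fg by (simp add: cls_def)
      ultimately have "g \<in> cls f" by simp
      then show "eventually (\<lambda>i. f i = g i) U" by (simp add: cls_def)
    next
      assume ev: "eventually (\<lambda>i. f i = g i) U"
      have "eventually (\<lambda>i. f i = e i) U" if "eventually (\<lambda>i. g i = e i) U" for e
        using ev that by eventually_elim simp
      moreover have "eventually (\<lambda>i. g i = e i) U" if "eventually (\<lambda>i. f i = e i) U" for e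
        using ev that by eventually_elim simp
      ultimately have "eventually (\<lambda>i. f i = e i) U \<longleftrightarrow> eventually (\<lambda>i. g i = e i) U" for e
        by blast
      then show "cls f = cls g" by (simp add: cls_def)
    qed
    finally show ?thesis .
  qed
  then show ?thesis using that by blast
qed

section \<open>The theorem of Los for subproducts\<close>

locale ultra =
  fixes U :: "nat filter"
  assumes proper: "U \<noteq> bot"
    and ultra: "eventually P U \<or> eventually (\<lambda>i. \<not> P i) U"
begin

lemma eventually_not: "eventually (\<lambda>i. \<not> P i) U \<longleftrightarrow> \<not> eventually P U"
  using proper ultra[of P] eventually_conj_iff[of P "\<lambda>i. \<not> P i" U]
  by (auto simp: trivial_limit_def)

lemma eventually_or: "eventually (\<lambda>i. P i \<or> Q i) U \<longleftrightarrow> eventually P U \<or> eventually Q U"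
  using eventually_not[of "\<lambda>i. P i \<or> Q i"]
  by (simp add: eventually_conj_iff eventually_not) blast

end

primrec fo_subs :: "('p, 'n) fo \<Rightarrow> ('p, 'n) fo set" where
  "fo_subs FBot = {FBot}"
| "fo_subs (FEq t u) = {FEq t u}"
| "fo_subs (FRel t u) = {FRel t u}"
| "fo_subs (FPred p t) = {FPred p t}"
| "fo_subs (FNeg \<phi>) = insert (FNeg \<phi>) (fo_subs \<phi>)"
| "fo_subs (FOr \<phi> \<chi>) = insert (FOr \<phi> \<chi>) (fo_subs \<phi> \<union> fo_subs \<chi>)"
| "fo_subs (FEx i \<phi>) = insert (FEx i \<phi>) (fo_subs \<phi>)"

lemma finite_fo_subs: "finite (fo_subs \<phi>)"
  by (induction \<phi>) auto

text \<open>Finite lists over a countable set are countably many, so a countable closure can hold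
  witnesses for all assignments of this form. The empty list gives the constant assignment of
  \<open>fo_true\<close>.\<close>

definition list_asg :: "'a \<Rightarrow> 'a list \<Rightarrow> nat \<Rightarrow> 'a" where
  "list_asg d xs w = (if w < length xs then xs ! w else d)"

lemma list_asg_Nil [simp]: "list_asg d [] = (\<lambda>_. d)"
  by (simp add: list_asg_def fun_eq_iff)

lemma list_asg_mem: "d \<in> C \<Longrightarrow> set xs \<subseteq> C \<Longrightarrow> list_asg d xs w \<in> C"
  using nth_mem by (auto simp: list_asg_def)

lemma list_asg_upd:
  assumes "d \<in> C" "set xs \<subseteq> C" "u \<in> C"
  obtains ys where "set ys \<subseteq> C" "list_asg d ys = (list_asg d xs)(w := u)"
proof
  \<comment> \<open>If \<open>w\<close> lies past the end of \<open>xs\<close>, the gap is padded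
    with \<open>d\<close>.\<close>
  let ?ys = "map ((list_asg d xs)(w := u)) [0..<max (length xs) (Suc w)]"
  show "set ?ys \<subseteq> C" using assms list_asg_mem by auto
  show "list_asg d ?ys = (list_asg d xs)(w := u)"
    by (auto simp: list_asg_def fun_eq_iff simp del: upt_Suc)
qed

text \<open>A submodel of the ultraproduct of the models \<open>A i\<close>: \<open>C\<close> is a set of representatives of its
  elements, \<open>d \<in> C\<close> a default one, and \<open>q\<close> names the equivalence classes by elements of \<open>'u\<close>.\<close>

locale subproduct = ultra U for U :: "nat filter" +
  fixes PROPS :: "'p set" and NOMS :: "'n set" and A :: "nat \<Rightarrow> ('u, 'p, 'n) model"
    and C :: "(nat \<Rightarrow> 'u) set" and d :: "nat \<Rightarrow> 'u" and q :: "(nat \<Rightarrow> 'u) \<Rightarrow> 'u"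
  assumes A: "model_over PROPS NOMS (A i)"
    and C: "f \<in> C \<Longrightarrow> f i \<in> carrier (A i)"
    and d: "d \<in> C"
    and noms: "s \<in> NOMS \<Longrightarrow> (\<lambda>i. nomi (A i) s) \<in> C"
    and q: "f \<in> C \<Longrightarrow> g \<in> C \<Longrightarrow> q f = q g \<longleftrightarrow> eventually (\<lambda>i. f i = g i) U"
begin

definition prodm :: "('u, 'p, 'n) model" where
  "prodm = \<lparr>carrier = q ` C,
    rel = {(q f, q g) | f g. f \<in> C \<and> g \<in> C \<and> eventually (\<lambda>i. (f i, g i) \<in> rel (A i)) U},
    nomi = (\<lambda>s. q (\<lambda>i. nomi (A i) s)),
    val = (\<lambda>p. {q f | f. f \<in> C \<and> eventually (\<lambda>i. f i \<in> val (A i) p) U})\<rparr>"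

lemma carrier_prodm: "carrier prodm = q ` C"
  by (simp add: prodm_def)

lemma nomi_prodm: "nomi prodm s = q (\<lambda>i. nomi (A i) s)"
  by (simp add: prodm_def)

text \<open>Independence of representatives: functions with equal \<open>q\<close> values agree at
  almost all indices, and finitely many large sets intersect in a large set.\<close>

lemma rel_prodm:
  assumes "f \<in> C" "g \<in> C"
  shows "(q f, q g) \<in> rel prodm \<longleftrightarrow> eventually (\<lambda>i. (f i, g i) \<in> rel (A i)) U"
proof
  assume "(q f, q g) \<in> rel prodm"
  then obtain f' g' where "f' \<in> C" "g' \<in> C" "q f = q f'" "q g = q g'"
    and R: "eventually (\<lambda>i. (f' i, g' i) \<in> rel (A i)) U"
    by (auto simp: prodm_def)
  then have "eventually (\<lambda>i. f i = f' i) U" "eventually (\<lambda>i. g i = g' i) U"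
    using q assms by auto
  with R show "eventually (\<lambda>i. (f i, g i) \<in> rel (A i)) U"
    by eventually_elim simp
qed (use assms in \<open>auto simp: prodm_def\<close>)

lemma val_prodm:
  assumes "f \<in> C"
  shows "q f \<in> val prodm p \<longleftrightarrow> eventually (\<lambda>i. f i \<in> val (A i) p) U"
proof
  assume "q f \<in> val prodm p"
  then obtain f' where "f' \<in> C" "q f = q f'" and V: "eventually (\<lambda>i. f' i \<in> val (A i) p) U"
    by (auto simp: prodm_def)
  then have "eventually (\<lambda>i. f i = f' i) U" using q assms by auto
  with V show "eventually (\<lambda>i. f i \<in> val (A i) p) U"
    by eventually_elim simp
qed (use assms in \<open>auto simp: prodm_def\<close>)

lemma model_over_prodm: "model_over PROPS NOMS prodm"
  using d noms by (auto simp: model_over_def prodm_def)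

text \<open>Replaces variables and constants alike by a representative in \<open>C\<close>, which
  reduces the atomic cases of \<open>los\<close> to \<open>q\<close>, \<open>rel_prodm\<close> and
  \<open>val_prodm\<close>.\<close>

lemma term_val_prodm:
  assumes "set xs \<subseteq> C" "term_over NOMS t"
  shows "\<exists>f\<in>C. term_val prodm (\<lambda>w. q (list_asg d xs w)) t = q f \<and>
    (\<forall>i. term_val (A i) (\<lambda>w. list_asg d xs w i) t = f i)"
proof (cases t)
  case (FVar w)
  then show ?thesis using list_asg_mem[OF d assms(1)] by auto
next
  case (FConst s)
  then show ?thesis using noms assms(2) by (auto simp: nomi_prodm)
qed

text \<open>The connectives are handled by the ultrafilter. For a quantifier, witnesses chosen index
  by index must form a function in \<open>C\<close>; \<open>skolem\<close> asks this only for the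
  existential subformulas of \<open>\<phi>\<close>.\<close>

lemma los:
  assumes skolem: "\<And>\<chi> v xs. FEx v \<chi> \<in> fo_subs \<phi> \<Longrightarrow> set xs \<subseteq> C \<Longrightarrow>
    pick A (\<lambda>i c u. fo_sat (A i) ((\<lambda>w. list_asg d xs w i)(v := u)) \<chi>) \<in> C"
  shows "fo_over PROPS NOMS \<phi> \<Longrightarrow> set xs \<subseteq> C \<Longrightarrow>
    fo_sat prodm (\<lambda>w. q (list_asg d xs w)) \<phi> \<longleftrightarrow> eventually (\<lambda>i. fo_sat (A i) (\<lambda>w. list_asg d xs w i) \<phi>) U"
  \<comment> \<open>The condition \<open>skolem\<close> mentions \<open>\<phi>\<close>, so it enters
    the induction as a premise and is inherited by subformulas.\<close>
  using assms
proof (induction \<phi> arbitrary: xs)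
  case FBot
  then show ?case using proper by (simp add: trivial_limit_def)
next
  case (FEq t u)
  obtain f where f: "f \<in> C" "term_val prodm (\<lambda>w. q (list_asg d xs w)) t = q f"
    "\<forall>i. term_val (A i) (\<lambda>w. list_asg d xs w i) t = f i"
    using term_val_prodm[of xs t] FEq.prems by auto
  obtain g where g: "g \<in> C" "term_val prodm (\<lambda>w. q (list_asg d xs w)) u = q g"
    "\<forall>i. term_val (A i) (\<lambda>w. list_asg d xs w i) u = g i"
    using term_val_prodm[of xs u] FEq.prems by auto
  show ?case using q[OF f(1) g(1)] by (simp add: f g)
next
  case (FRel t u)
  obtain f where f: "f \<in> C" "term_val prodm (\<lambda>w. q (list_asg d xs w)) t = q f"
    "\<forall>i. term_val (A i) (\<lambda>w. list_asg d xs w i) t = f i"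
    using term_val_prodm[of xs t] FRel.prems by auto
  obtain g where g: "g \<in> C" "term_val prodm (\<lambda>w. q (list_asg d xs w)) u = q g"
    "\<forall>i. term_val (A i) (\<lambda>w. list_asg d xs w i) u = g i"
    using term_val_prodm[of xs u] FRel.prems by auto
  show ?case using rel_prodm[OF f(1) g(1)] by (simp add: f g)
next
  case (FPred p t)
  obtain f where f: "f \<in> C" "term_val prodm (\<lambda>w. q (list_asg d xs w)) t = q f"
    "\<forall>i. term_val (A i) (\<lambda>w. list_asg d xs w i) t = f i"
    using term_val_prodm[of xs t] FPred.prems by auto
  show ?case using val_prodm[OF f(1)] by (simp add: f)
next
  case (FNeg \<phi>)
  then show ?case by (simp add: eventually_not)
next
  case (FOr \<phi> \<chi>)
  then show ?case by (simp add: eventually_or)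
next
  case (FEx v \<phi>)
  have IH: "fo_sat prodm ((\<lambda>w. q (list_asg d xs w))(v := q g)) \<phi> \<longleftrightarrow>
      eventually (\<lambda>i. fo_sat (A i) ((\<lambda>w. list_asg d xs w i)(v := g i)) \<phi>) U" if "g \<in> C" for g
  proof -
    obtain ys where ys: "set ys \<subseteq> C" "list_asg d ys = (list_asg d xs)(v := g)"
      using list_asg_upd[OF d FEx.prems(2) \<open>g \<in> C\<close>] .
    have "(\<lambda>w. q (((list_asg d xs)(v := g)) w)) = (\<lambda>w. q (list_asg d xs w))(v := q g)"
      "(\<lambda>w. ((list_asg d xs)(v := g)) w i) = (\<lambda>w. list_asg d xs w i)(v := g i)" for i
      by auto
    then show ?thesis
      using FEx.IH[OF _ ys(1)] FEx.prems(1,3) by (simp add: ys(2))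
  qed
  define g where "g = pick A (\<lambda>i c u. fo_sat (A i) ((\<lambda>w. list_asg d xs w i)(v := u)) \<phi>)"
  have g: "g \<in> C"
    unfolding g_def by (rule FEx.prems(3)) (use FEx.prems(2) in auto)
  have "carrier (A i) \<noteq> {}" for i using A by (auto simp: model_over_def)
  \<comment> \<open>The condition given to \<open>pick\<close> ignores \<open>c\<close>, so the
    instance \<open>0\<close>, which is within the bound at every index, yields a witness wherever
    there is one.\<close>
  then have wit: "fo_sat (A i) ((\<lambda>w. list_asg d xs w i)(v := g i)) \<phi>"
    if "\<exists>u\<in>carrier (A i). fo_sat (A i) ((\<lambda>w. list_asg d xs w i)(v := u)) \<phi>" for i
    using that pick(2)[of A i "\<lambda>i c u. fo_sat (A i) ((\<lambda>w. list_asg d xs w i)(v := u)) \<phi>" 0]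
    unfolding g_def by blast
  show ?case
  proof
    assume "fo_sat prodm (\<lambda>w. q (list_asg d xs w)) (FEx v \<phi>)"
    then obtain f where f: "f \<in> C" "fo_sat prodm ((\<lambda>w. q (list_asg d xs w))(v := q f)) \<phi>"
      by (auto simp: carrier_prodm)
    then have "eventually (\<lambda>i. fo_sat (A i) ((\<lambda>w. list_asg d xs w i)(v := f i)) \<phi>) U"
      using IH by blast
    then show "eventually (\<lambda>i. fo_sat (A i) (\<lambda>w. list_asg d xs w i) (FEx v \<phi>)) U"
      by eventually_elim (use C[OF f(1)] in auto)
  next
    assume "eventually (\<lambda>i. fo_sat (A i) (\<lambda>w. list_asg d xs w i) (FEx v \<phi>)) U"
    then have "eventually (\<lambda>i. fo_sat (A i) ((\<lambda>w. list_asg d xs w i)(v := g i)) \<phi>) U"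
      by eventually_elim (use wit in auto)
    then show "fo_sat prodm (\<lambda>w. q (list_asg d xs w)) (FEx v \<phi>)"
      using IH[OF g] g by (auto simp: carrier_prodm)
  qed
qed

end


section \<open>A bisimulation between ultraproducts\<close>

definition at_index :: "nat \<Rightarrow> (nat \<Rightarrow> 'u) list \<Rightarrow> 'u list" where
  "at_index i fs = map (\<lambda>f. f i) fs"

lemma at_index_simps [simp]:
  "length (at_index i fs) = length fs"
  "at_index i (fs @ [f]) = at_index i fs @ [f i]"
  "at_index i (fs[j := f]) = (at_index i fs)[j := f i]"
  "j < length fs \<Longrightarrow> at_index i fs ! j = (fs ! j) i"
  "at_index i [] = []"
  by (simp_all add: at_index_def map_update)

text \<open>The large set of indices may depend on \<open>c\<close>; agreement at all ranks at one
  index is not demanded.\<close>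

definition uagree :: "nat filter \<Rightarrow> feature set \<Rightarrow> 'p list \<Rightarrow> 'n list \<Rightarrow>
    (nat \<Rightarrow> ('u, 'p, 'n) model) \<Rightarrow> (nat \<Rightarrow> 'u) list \<Rightarrow> (nat \<Rightarrow> 'u) \<Rightarrow>
    (nat \<Rightarrow> ('u, 'p, 'n) model) \<Rightarrow> (nat \<Rightarrow> 'u) list \<Rightarrow> (nat \<Rightarrow> 'u) \<Rightarrow> bool" where
  "uagree U F ps nl M ms m N ns n \<longleftrightarrow>
    (\<forall>c. eventually (\<lambda>i. agree F ps nl c (M i) (at_index i ms) (m i) (N i) (at_index i ns) (n i)) U)"

lemma uagree_sym: "uagree U F ps nl M ms m N ns n \<longleftrightarrow> uagree U F ps nl N ns n M ms m"
  by (simp add: uagree_def agree_sym)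

lemma uagreeD:
  "uagree U F ps nl M ms m N ns n \<Longrightarrow>
    eventually (\<lambda>i. agree F ps nl c (M i) (at_index i ms) (m i) (N i) (at_index i ns) (n i)) U"
  by (simp add: uagree_def)

text \<open>A condition for \<open>pick\<close>: \<open>v\<close> is a reply at index
  \<open>i\<close> to the move to \<open>m'\<close> that keeps agreement at rank \<open>c\<close>.
  Exchanging the two sides gives the replies for (back).\<close>

definition dia_query where
  "dia_query F ps nl M ms m' N ns n = (\<lambda>i c v. (n i, v) \<in> rel (N i) \<and>
    agree F ps nl c (M i) (at_index i ms) (m' i) (N i) (at_index i ns) v)"

definition ex_query where
  "ex_query F ps nl M ms m N ns n j = (\<lambda>i c v.
    agree F ps nl c (M i) (at_index i ms) (m i) (N i) ((at_index i ns)[j := v]) (n i))"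

definition sat_query where
  "sat_query N d xs v \<chi> = (\<lambda>i c u. fo_sat (N i) ((\<lambda>w. list_asg d xs w i)(v := u)) \<chi>)"

text \<open>The arguments describe the position after the opponent's move: \<open>m\<close> is the
  world moved to in the first query, \<open>ms\<close> the updated tuple in the second. In the
  third, \<open>ns\<close> codes a first-order assignment.\<close>

definition witnesses where
  "witnesses F ps nl \<phi> M N d ms m ns n =
    insert (pick N (dia_query F ps nl M ms m N ns n))
     (range (\<lambda>j. pick N (ex_query F ps nl M ms m N ns n j)) \<union>
      {pick N (sat_query N d ns v \<chi>) | v \<chi>. FEx v \<chi> \<in> fo_subs \<phi>})"

lemma countable_witnesses: "countable (witnesses F ps nl \<phi> M N d ms m ns n)"
proof -
  have "{pick N (sat_query N d ns v \<chi>) | v \<chi>. FEx v \<chi> \<in> fo_subs \<phi>}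
    \<subseteq> (\<lambda>\<psi>. case \<psi> of FEx v \<chi> \<Rightarrow> pick N (sat_query N d ns v \<chi>)) ` fo_subs \<phi>"
    by force
  then have "countable {pick N (sat_query N d ns v \<chi>) | v \<chi>. FEx v \<chi> \<in> fo_subs \<phi>}"
    using finite_fo_subs by (meson countable_finite finite_imageI finite_subset)
  then show ?thesis by (simp add: witnesses_def)
qed

lemma dia_query_mono: "c \<le> e \<Longrightarrow> dia_query F ps nl M ms m N ns n i e u \<Longrightarrow> dia_query F ps nl M ms m N ns n i c u"
  by (auto simp: dia_query_def intro: agree_mono)

lemma ex_query_mono: "c \<le> e \<Longrightarrow> ex_query F ps nl M ms m N ns n j i e u \<Longrightarrow> ex_query F ps nl M ms m N ns n j i c u"
  by (auto simp: ex_query_def intro: agree_mono)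

lemma witnesses_carrier:
  assumes "\<And>i. carrier (N i) \<noteq> {}" "f \<in> witnesses F ps nl \<phi> M N d ms m ns n"
  shows "f i \<in> carrier (N i)"
proof -
  have "pick N (dia_query F ps nl M ms m N ns n) i \<in> carrier (N i)"
    by (rule pick(1)[OF assms(1) dia_query_mono])
  moreover have "pick N (ex_query F ps nl M ms m N ns n j) i \<in> carrier (N i)" for j
    by (rule pick(1)[OF assms(1) ex_query_mono])
  moreover have "pick N (sat_query N d ns v \<chi>) i \<in> carrier (N i)" for v \<chi>
    by (rule pick(1)[OF assms(1)]) (simp add: sat_query_def)
  ultimately show ?thesis
    using assms(2) by (auto simp: witnesses_def)
qed

text \<open>Countable saturation: at almost all \<open>i\<close> there is agreement at rank
  \<open>Suc c\<close>, hence a reply keeping rank \<open>c\<close>, and \<open>pick\<close> finds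
  one as soon as \<open>c \<le> i\<close>. As \<open>U\<close> refines \<open>sequentially\<close>,
  this covers almost all \<open>i\<close> for each \<open>c\<close>, with the same \<open>n'\<close>
  throughout.\<close>

lemma uagree_dia:
  assumes U: "U \<le> sequentially" and N: "\<And>i. model_over PROPS NOMS (N i)"
    and "uagree U F ps nl M ms m N ns n" and "eventually (\<lambda>i. (m i, m' i) \<in> rel (M i)) U"
  defines "n' \<equiv> pick N (dia_query F ps nl M ms m' N ns n)"
  shows "eventually (\<lambda>i. (n i, n' i) \<in> rel (N i)) U" "uagree U F ps nl M ms m' N ns n'"
proof -
  have ne: "carrier (N i) \<noteq> {}" for i
    using N by (simp add: model_over_def)
  have "eventually (\<lambda>i. dia_query F ps nl M ms m' N ns n i c (n' i)) U" for c
    using uagreeD[OF assms(3), of "Suc c"] assms(4) filter_leD[OF U eventually_ge_at_top[of c]]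
  proof eventually_elim
    case (elim i)
    obtain v where v: "(n i, v) \<in> rel (N i)"
      "agree F ps nl c (M i) (at_index i ms) (m' i) (N i) (at_index i ns) v"
      using agree_moves(5)[OF elim(1,2)] by blast
    show ?case unfolding n'_def
    proof (rule pick(2)[where A = N, OF ne dia_query_mono elim(3)])
      show "v \<in> carrier (N i)" using N[of i] v(1) by (auto simp: model_over_def)
      show "dia_query F ps nl M ms m' N ns n i c v" using v by (simp add: dia_query_def)
    qed
  qed
  then show "eventually (\<lambda>i. (n i, n' i) \<in> rel (N i)) U" "uagree U F ps nl M ms m' N ns n'"
    unfolding dia_query_def uagree_def by (auto simp: eventually_conj_iff)
qed

text \<open>The saturation argument of \<open>uagree_dia\<close>, with the reply entering the tuple
  instead of becoming the current world.\<close>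

lemma uagree_ex:
  assumes U: "U \<le> sequentially" and N: "\<And>i. model_over PROPS NOMS (N i)"
    and "uagree U F ps nl M ms m N ns n" and "Ex \<in> F" "j < length ms" "\<And>i. u i \<in> carrier (M i)"
  defines "u' \<equiv> pick N (ex_query F ps nl M (ms[j := u]) m N ns n j)"
  shows "uagree U F ps nl M (ms[j := u]) m N (ns[j := u']) n"
proof -
  have ne: "carrier (N i) \<noteq> {}" for i
    using N by (simp add: model_over_def)
  have "eventually (\<lambda>i. ex_query F ps nl M (ms[j := u]) m N ns n j i c (u' i)) U" for c
    using uagreeD[OF assms(3), of "Suc c"] filter_leD[OF U eventually_ge_at_top[of c]]
  proof eventually_elim
    case (elim i)
    obtain v where v: "v \<in> carrier (N i)"
      "agree F ps nl c (M i) ((at_index i ms)[j := u i]) (m i) (N i) ((at_index i ns)[j := v]) (n i)"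
      using agree_moves(6)[OF elim(1) assms(4) _ assms(6)] assms(5) by auto
    then have "ex_query F ps nl M (ms[j := u]) m N ns n j i c v"
      by (simp add: ex_query_def)
    with elim(2) v(1) show ?case unfolding u'_def
      by (intro pick(2)[where A = N and P = "ex_query F ps nl M (ms[j := u]) m N ns n j"] ne)
        (rule ex_query_mono)
  qed
  then show ?thesis
    by (simp add: ex_query_def uagree_def)
qed

text \<open>The default functions \<open>dM\<close> and \<open>dN\<close> double as the
  distinguished worlds, so the assignment coded by the empty list is the one \<open>fo_true\<close>
  uses. Closure is mutual, because a reply on one side depends on the position on both.\<close>

locale agreeing_products =
  MM: subproduct U PROPS NOMS M CM dM qM + NN: subproduct U PROPS NOMS N CN dN qN
  for U and PROPS :: "'p set" and NOMS :: "'n set" and M :: "nat \<Rightarrow> ('u, 'p, 'n) model" and CM dM qM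
    and N :: "nat \<Rightarrow> ('u, 'p, 'n) model" and CN dN qN +
  fixes F :: "feature set" and ps nl \<phi>
  assumes U: "U \<le> sequentially"
    and ps: "set ps = PROPS" and nl: "set nl = NOMS"
    and closM: "\<lbrakk>set ms \<subseteq> CM; m \<in> CM; set ns \<subseteq> CN; n \<in> CN\<rbrakk> \<Longrightarrow> witnesses F ps nl \<phi> N M dM ns n ms m \<subseteq> CM"
    and closN: "\<lbrakk>set ms \<subseteq> CM; m \<in> CM; set ns \<subseteq> CN; n \<in> CN\<rbrakk> \<Longrightarrow> witnesses F ps nl \<phi> M N dN ms m ns n \<subseteq> CN"
    and start: "uagree U F ps nl M [] dM N [] dN"
begin

text \<open>Agreement is asked of some representatives; \<open>rel_prodm\<close>,
  \<open>val_prodm\<close> and \<open>q\<close> translate statements about classes into statements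
  about these.\<close>

definition bisim :: "nat \<Rightarrow> (('u list \<times> 'u) \<times> ('u list \<times> 'u)) set" where
  "bisim k = {((map qM ms, qM m), (map qN ns, qN n)) | ms m ns n. length ms = k \<and> length ns = k \<and>
    set ms \<subseteq> CM \<and> m \<in> CM \<and> set ns \<subseteq> CN \<and> n \<in> CN \<and> uagree U F ps nl M ms m N ns n}"

lemma bisimI:
  "\<lbrakk>ms' = map qM ms; m' = qM m; ns' = map qN ns; n' = qN n; length ms = k; length ns = k;
    set ms \<subseteq> CM; m \<in> CM; set ns \<subseteq> CN; n \<in> CN; uagree U F ps nl M ms m N ns n\<rbrakk> \<Longrightarrow>
    ((ms', m'), (ns', n')) \<in> bisim k"
  unfolding bisim_def by blast

section \<open>The bisimulation clauses for fixed agreeing representatives\<close>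

context
  fixes k ms m ns n
  assumes len: "length ms = k" "length ns = k"
    and C: "set ms \<subseteq> CM" "m \<in> CM" "set ns \<subseteq> CN" "n \<in> CN"
    and ag: "uagree U F ps nl M ms m N ns n"
begin

text \<open>Atoms already occur at rank 0, so the two events coincide at almost all indices.\<close>

lemma bisim_prop:
  assumes "p \<in> PROPS"
  shows "qM m \<in> val MM.prodm p \<longleftrightarrow> qN n \<in> val NN.prodm p"
  unfolding MM.val_prodm[OF C(2)] NN.val_prodm[OF C(4)]
  by (rule eventually_subst, rule eventually_mono[OF uagreeD[OF ag, of 0]])
    (use assms ps in \<open>auto dest: agree_atoms(2)\<close>)

lemma bisim_wvar:
  assumes "j < k"
  shows "map qM ms ! j = qM m \<longleftrightarrow> map qN ns ! j = qN n"
proof -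
  have mem: "ms ! j \<in> CM" "ns ! j \<in> CN" using assms len C by auto
  have "eventually (\<lambda>i. (ms ! j) i = m i) U \<longleftrightarrow> eventually (\<lambda>i. (ns ! j) i = n i) U"
    by (rule eventually_subst, rule eventually_mono[OF uagreeD[OF ag, of 0]])
      (use assms len in \<open>auto dest: agree_atoms(3)[where j = j]\<close>)
  then show ?thesis
    using MM.q[OF mem(1) C(2)] NN.q[OF mem(2) C(4)] assms len by simp
qed

lemma bisim_nom:
  assumes "Nom \<in> F" "s \<in> NOMS"
  shows "qM m = nomi MM.prodm s \<longleftrightarrow> qN n = nomi NN.prodm s"
  unfolding MM.nomi_prodm NN.nomi_prodm MM.q[OF C(2) MM.noms[OF assms(2)]]
    NN.q[OF C(4) NN.noms[OF assms(2)]]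
  by (rule eventually_subst, rule eventually_mono[OF uagreeD[OF ag, of 0]])
    (use assms nl in \<open>auto dest: agree_atoms(4)\<close>)

lemma bisim_forth:
  assumes "(qM m, x) \<in> rel MM.prodm"
  shows "\<exists>y. (qN n, y) \<in> rel NN.prodm \<and> ((map qM ms, x), (map qN ns, y)) \<in> bisim k"
proof -
  obtain m' where m': "m' \<in> CM" "x = qM m'"
    using assms MM.model_over_prodm by (auto simp: model_over_def MM.carrier_prodm)
  have R: "eventually (\<lambda>i. (m i, m' i) \<in> rel (M i)) U"
    using assms m' MM.rel_prodm[OF C(2)] by simp
  define n' where "n' = pick N (dia_query F ps nl M ms m' N ns n)"
  have n': "n' \<in> CN"
    \<comment> \<open>Closure is applied to the position in which the first player has already moved
      to \<open>m'\<close>.\<close>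
    using closN[OF C(1) m'(1) C(3,4)] by (auto simp: witnesses_def n'_def)
  note step = uagree_dia[OF U NN.A ag R, folded n'_def]
  have "(qN n, qN n') \<in> rel NN.prodm"
    using NN.rel_prodm[OF C(4) n'] step(1) by simp
  moreover have "((map qM ms, x), (map qN ns, qN n')) \<in> bisim k"
    by (rule bisimI[of _ ms _ m' _ ns _ n']) (use m' n' len C step(2) in auto)
  ultimately show ?thesis by blast
qed

lemma bisim_back:
  assumes "(qN n, y) \<in> rel NN.prodm"
  shows "\<exists>x. (qM m, x) \<in> rel MM.prodm \<and> ((map qM ms, x), (map qN ns, y)) \<in> bisim k"
proof -
  obtain n' where n': "n' \<in> CN" "y = qN n'"
    using assms NN.model_over_prodm by (auto simp: model_over_def NN.carrier_prodm)
  have R: "eventually (\<lambda>i. (n i, n' i) \<in> rel (N i)) U"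
    using assms n' NN.rel_prodm[OF C(4)] by simp
  define m' where "m' = pick M (dia_query F ps nl N ns n' M ms m)"
  have m': "m' \<in> CM"
    using closM[OF C(1,2,3) n'(1)] by (auto simp: witnesses_def m'_def)
  \<comment> \<open>With the two sides exchanged, the same lemma produces the reply in the first
    product.\<close>
  note step = uagree_dia[OF U MM.A ag[unfolded uagree_sym[of U F ps nl M]] R, folded m'_def]
  have "(qM m, qM m') \<in> rel MM.prodm"
    using MM.rel_prodm[OF C(2) m'] step(1) by simp
  moreover have "((map qM ms, qM m'), (map qN ns, y)) \<in> bisim k"
    by (rule bisimI[of _ ms _ m' _ ns _ n']) (use m' n' len C step(2)[THEN uagree_sym[THEN iffD1]] in auto)
  ultimately show ?thesis by blast
qed

text \<open>A move costs one rank, and agreement at every rank survives that loss. The same holds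
  for the other forced moves.\<close>

lemma bisim_ext: "((map qM ms @ [qM m], qM m), (map qN ns @ [qN n], qN n)) \<in> bisim (Suc k)"
proof (rule bisimI[of _ "ms @ [m]" _ m _ "ns @ [n]" _ n])
  show "uagree U F ps nl M (ms @ [m]) m N (ns @ [n]) n"
    unfolding uagree_def
  proof
    fix c
    show "eventually (\<lambda>i. agree F ps nl c (M i) (at_index i (ms @ [m])) (m i) (N i) (at_index i (ns @ [n])) (n i)) U"
      using uagreeD[OF ag, of "Suc c"]
    proof eventually_elim
      case (elim i)
      show ?case using agree_moves(1)[OF elim MM.C[OF C(2)] NN.C[OF C(4)]] by simp
    qed
  qed
qed (use C len in auto)

text \<open>Overwriting an entry by the current world is governed by \<open>down F j\<close>, which
  occurs in rank \<open>Suc c\<close> for every feature set.\<close>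

lemma bisim_bind:
  assumes "j < k"
  shows "(((map qM ms)[j := qM m], qM m), ((map qN ns)[j := qN n], qN n)) \<in> bisim k"
proof (rule bisimI[of _ "ms[j := m]" _ m _ "ns[j := n]" _ n])
  show "uagree U F ps nl M (ms[j := m]) m N (ns[j := n]) n"
    unfolding uagree_def
  proof
    fix c
    show "eventually (\<lambda>i. agree F ps nl c (M i) (at_index i (ms[j := m])) (m i) (N i) (at_index i (ns[j := n])) (n i)) U"
      using uagreeD[OF ag, of "Suc c"]
    proof eventually_elim
      case (elim i)
      show ?case using agree_moves(2)[OF elim MM.C[OF C(2)] NN.C[OF C(4)], of j] assms len by simp
    qed
  qed
qed (use C len set_update_subset_insert[of ms j m] set_update_subset_insert[of ns j n] in \<open>auto simp: map_update\<close>)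

lemma bisim_atv:
  assumes "At \<in> F" "j < k"
  shows "((map qM ms, map qM ms ! j), (map qN ns, map qN ns ! j)) \<in> bisim k"
proof (rule bisimI[of _ ms _ "ms ! j" _ ns _ "ns ! j"])
  show "uagree U F ps nl M ms (ms ! j) N ns (ns ! j)"
    unfolding uagree_def
  proof
    fix c
    show "eventually (\<lambda>i. agree F ps nl c (M i) (at_index i ms) ((ms ! j) i) (N i) (at_index i ns) ((ns ! j) i)) U"
      using uagreeD[OF ag, of "Suc c"]
    proof eventually_elim
      case (elim i)
      show ?case using agree_moves(3)[OF elim assms(1), of j] assms(2) len by simp
    qed
  qed
qed (use C len assms in auto)

lemma bisim_atn:
  assumes "At \<in> F" "Nom \<in> F" "s \<in> NOMS"
  shows "((map qM ms, nomi MM.prodm s), (map qN ns, nomi NN.prodm s)) \<in> bisim k"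
proof (rule bisimI[of _ ms _ "\<lambda>i. nomi (M i) s" _ ns _ "\<lambda>i. nomi (N i) s"])
  show "uagree U F ps nl M ms (\<lambda>i. nomi (M i) s) N ns (\<lambda>i. nomi (N i) s)"
    unfolding uagree_def
  proof
    fix c
    show "eventually (\<lambda>i. agree F ps nl c (M i) (at_index i ms) (nomi (M i) s) (N i) (at_index i ns) (nomi (N i) s)) U"
      using uagreeD[OF ag, of "Suc c"]
    proof eventually_elim
      case (elim i)
      show ?case using agree_moves(4)[OF elim assms(1,2), of s] assms(3) nl by simp
    qed
  qed
qed (use C len MM.noms[OF assms(3)] NN.noms[OF assms(3)] MM.nomi_prodm NN.nomi_prodm in auto)

lemma bisim_ex:
  assumes "Ex \<in> F" "j < k" "x \<in> carrier MM.prodm"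
  shows "\<exists>y\<in>carrier NN.prodm. (((map qM ms)[j := x], qM m), ((map qN ns)[j := y], qN n)) \<in> bisim k"
proof -
  obtain u where u: "u \<in> CM" "x = qM u" using assms(3) by (auto simp: MM.carrier_prodm)
  define u' where "u' = pick N (ex_query F ps nl M (ms[j := u]) m N ns n j)"
  have sub: "set (ms[j := u]) \<subseteq> CM" using C(1) u(1) set_update_subset_insert[of ms j u] by auto
  have u': "u' \<in> CN" using closN[OF sub C(2,3,4)] by (auto simp: witnesses_def u'_def)
  have "j < length ms" using assms(2) len by simp
  note step = uagree_ex[OF U NN.A ag assms(1) this MM.C[OF u(1)], folded u'_def]
  have "(((map qM ms)[j := x], qM m), ((map qN ns)[j := qN u'], qN n)) \<in> bisim k"
    by (rule bisimI[of _ "ms[j := u]" _ m _ "ns[j := u']" _ n])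
      (use u u' sub C len step set_update_subset_insert[of ns j u'] in \<open>auto simp: map_update\<close>)
  then show ?thesis using u' by (auto simp: NN.carrier_prodm)
qed

lemma bisim_ex_back:
  assumes "Ex \<in> F" "j < k" "y \<in> carrier NN.prodm"
  shows "\<exists>x\<in>carrier MM.prodm. (((map qM ms)[j := x], qM m), ((map qN ns)[j := y], qN n)) \<in> bisim k"
proof -
  obtain u where u: "u \<in> CN" "y = qN u" using assms(3) by (auto simp: NN.carrier_prodm)
  define u' where "u' = pick M (ex_query F ps nl N (ns[j := u]) n M ms m j)"
  have sub: "set (ns[j := u]) \<subseteq> CN" using C(3) u(1) set_update_subset_insert[of ns j u] by auto
  have u': "u' \<in> CM" using closM[OF C(1,2) sub C(4)] by (auto simp: witnesses_def u'_def)
  have "j < length ns" using assms(2) len by simp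
  note step = uagree_ex[OF U MM.A ag[unfolded uagree_sym[of U F ps nl M]] assms(1) this NN.C[OF u(1)],
      folded u'_def]
  have "(((map qM ms)[j := qM u'], qM m), ((map qN ns)[j := y], qN n)) \<in> bisim k"
    by (rule bisimI[of _ "ms[j := u']" _ m _ "ns[j := u]" _ n])
      (use u u' sub C len step[THEN uagree_sym[THEN iffD1]] set_update_subset_insert[of ms j u'] in
        \<open>auto simp: map_update\<close>)
  then show ?thesis using u' by (auto simp: MM.carrier_prodm)
qed

end

lemma omega_bisim_bisim: "omega_bisim F PROPS NOMS MM.prodm NN.prodm bisim"
  unfolding omega_bisim_def
proof (rule conjI, goal_cases)
  case 1
  have "(([], qM dM), ([], qN dN)) \<in> bisim 0"
    by (rule bisimI[of _ "[]" _ dM _ "[]" _ dN]) (use MM.d NN.d start in auto)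
  then show ?case by blast
next
  case 2
  show ?case
  proof (intro allI impI)
    fix k ms m ns n
    assume "((ms, m), (ns, n)) \<in> bisim k"
    then obtain ms' m' ns' n' where *: "length ms' = k" "length ns' = k" "set ms' \<subseteq> CM" "m' \<in> CM"
        "set ns' \<subseteq> CN" "n' \<in> CN" "uagree U F ps nl M ms' m' N ns' n'"
      and eq: "ms = map qM ms'" "m = qM m'" "ns = map qN ns'" "n = qN n'"
      unfolding bisim_def by blast
    note facts = bisim_prop[OF *] bisim_wvar[OF *] bisim_nom[OF *] bisim_forth[OF *] bisim_back[OF *]
      bisim_ext[OF *] bisim_bind[OF *] bisim_atv[OF *] bisim_atn[OF *] bisim_ex[OF *] bisim_ex_back[OF *]
    show "length ms = k \<and> set ms \<subseteq> carrier MM.prodm \<and> m \<in> carrier MM.prodm \<and>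
      length ns = k \<and> set ns \<subseteq> carrier NN.prodm \<and> n \<in> carrier NN.prodm \<and>
      (\<forall>p\<in>PROPS. m \<in> val MM.prodm p \<longleftrightarrow> n \<in> val NN.prodm p) \<and>
      (\<forall>j<k. ms ! j = m \<longleftrightarrow> ns ! j = n) \<and>
      (\<forall>m'. (m, m') \<in> rel MM.prodm \<longrightarrow> (\<exists>n'. (n, n') \<in> rel NN.prodm \<and> ((ms, m'), (ns, n')) \<in> bisim k)) \<and>
      (\<forall>n'. (n, n') \<in> rel NN.prodm \<longrightarrow> (\<exists>m'. (m, m') \<in> rel MM.prodm \<and> ((ms, m'), (ns, n')) \<in> bisim k)) \<and>
      ((ms @ [m], m), (ns @ [n], n)) \<in> bisim (Suc k) \<and>
      (Nom \<in> F \<longrightarrow> (\<forall>s\<in>NOMS. m = nomi MM.prodm s \<longleftrightarrow> n = nomi NN.prodm s)) \<and>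
      (Down \<in> F \<or> {Ex, At, Nom} \<subseteq> F \<longrightarrow>
        (\<forall>j<k. ((ms[j := m], m), (ns[j := n], n)) \<in> bisim k)) \<and>
      (At \<in> F \<longrightarrow> (\<forall>j<k. ((ms, ms ! j), (ns, ns ! j)) \<in> bisim k)) \<and>
      ({At, Nom} \<subseteq> F \<longrightarrow> (\<forall>s\<in>NOMS. ((ms, nomi MM.prodm s), (ns, nomi NN.prodm s)) \<in> bisim k)) \<and>
      (Ex \<in> F \<longrightarrow> (\<forall>j<k.
        (\<forall>u\<in>carrier MM.prodm. \<exists>u'\<in>carrier NN.prodm. ((ms[j := u], m), (ns[j := u'], n)) \<in> bisim k) \<and>
        (\<forall>u'\<in>carrier NN.prodm. \<exists>u\<in>carrier MM.prodm. ((ms[j := u], m), (ns[j := u'], n)) \<in> bisim k)))"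
      unfolding eq
    proof (intro conjI allI ballI impI)
      show "set (map qM ms') \<subseteq> carrier MM.prodm" "qM m' \<in> carrier MM.prodm"
        "set (map qN ns') \<subseteq> carrier NN.prodm" "qN n' \<in> carrier NN.prodm"
        using * by (auto simp: MM.carrier_prodm NN.carrier_prodm)
    qed (simp_all only: facts *(1,2) length_map insert_subset)
  qed
qed

lemma fo_true_prodm:
  assumes "fo_over PROPS NOMS \<phi>"
  shows "fo_true MM.prodm (qM dM) \<phi> \<longleftrightarrow> eventually (\<lambda>i. fo_true (M i) (dM i) \<phi>) U"
    and "fo_true NN.prodm (qN dN) \<phi> \<longleftrightarrow> eventually (\<lambda>i. fo_true (N i) (dN i) \<phi>) U"
proof -
  \<comment> \<open>The list \<open>xs\<close> takes the place of the tuple on the side of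
    \<open>M\<close>; the rest of the position is filled with the distinguished worlds and the empty
    tuple.\<close>
  have "pick M (sat_query M dM xs v \<chi>) \<in> CM" if "FEx v \<chi> \<in> fo_subs \<phi>" "set xs \<subseteq> CM" for \<chi> v xs
    using closM[OF that(2) MM.d _ NN.d, of "[]"] that(1) by (auto simp: witnesses_def)
  then show "fo_true MM.prodm (qM dM) \<phi> \<longleftrightarrow> eventually (\<lambda>i. fo_true (M i) (dM i) \<phi>) U"
    using MM.los[of \<phi> "[]"] assms by (simp add: fo_true_def sat_query_def)
  have "pick N (sat_query N dN xs v \<chi>) \<in> CN" if "FEx v \<chi> \<in> fo_subs \<phi>" "set xs \<subseteq> CN" for \<chi> v xs
    using closN[OF _ MM.d that(2) NN.d, of "[]"] that(1) by (auto simp: witnesses_def)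
  then show "fo_true NN.prodm (qN dN) \<phi> \<longleftrightarrow> eventually (\<lambda>i. fo_true (N i) (dN i) \<phi>) U"
    using NN.los[of \<phi> "[]"] assms by (simp add: fo_true_def sat_query_def)
qed

end

text \<open>Agreement at rank \<open>i\<close> at index \<open>i\<close> becomes agreement at every
  rank in the ultraproducts, which are therefore bisimilar, while \<open>los\<close> carries the
  separation by \<open>\<phi>\<close> over to them.\<close>

lemma invariant_not_separated:
  fixes PROPS :: "'p set" and NOMS :: "'n set" and M N :: "nat \<Rightarrow> ('u, 'p, 'n) model"
  assumes inf: "infinite (UNIV :: 'u set)" and ps: "set ps = PROPS" and nl: "set nl = NOMS"
    and \<phi>: "fo_over PROPS NOMS \<phi>" "omega_bisim_invariant TYPE('u) F PROPS NOMS \<phi>"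
    and M: "\<And>i. model_over PROPS NOMS (M i)" "\<And>i. m i \<in> carrier (M i)"
    and N: "\<And>i. model_over PROPS NOMS (N i)" "\<And>i. n i \<in> carrier (N i)"
    and ag: "\<And>i. agree F ps nl i (M i) [] (m i) (N i) [] (n i)"
    and sep: "\<And>i. fo_true (M i) (m i) \<phi>" "\<And>i. \<not> fo_true (N i) (n i) \<phi>"
  shows False
proof -
  obtain U :: "nat filter" where U: "U \<noteq> bot" "U \<le> sequentially"
    and ult: "\<And>P. eventually P U \<or> eventually (\<lambda>i. \<not> P i) U"
    using ultrafilter_exists[of sequentially] by auto
  let ?nM = "insert m ((\<lambda>s i. nomi (M i) s) ` NOMS)"
  let ?nN = "insert n ((\<lambda>s i. nomi (N i) s) ` NOMS)"
  have fin: "finite NOMS" using nl by auto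
  \<comment> \<open>A tuple together with its current world is coded as one non-empty list, split
    again by \<open>butlast\<close> and \<open>last\<close>. The bound
    \<open>witnesses_carrier\<close> holds for any arguments, including the unspecified
    \<open>last []\<close>.\<close>
  obtain CM CN where cnt: "countable CM" "countable CN"
    and base: "?nM \<subseteq> CM" "?nN \<subseteq> CN"
    and CM: "CM \<subseteq> {f. \<forall>i. f i \<in> carrier (M i)}" and CN: "CN \<subseteq> {f. \<forall>i. f i \<in> carrier (N i)}"
    and closed: "\<And>xs ys. set xs \<subseteq> CM \<Longrightarrow> set ys \<subseteq> CN \<Longrightarrow>
      witnesses F ps nl \<phi> N M m (butlast ys) (last ys) (butlast xs) (last xs) \<subseteq> CM \<and>
      witnesses F ps nl \<phi> M N n (butlast xs) (last xs) (butlast ys) (last ys) \<subseteq> CN"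
  proof (rule countable_closure_pair[of ?nM ?nN
        "\<lambda>xs ys. witnesses F ps nl \<phi> N M m (butlast ys) (last ys) (butlast xs) (last xs)"
        "\<lambda>xs ys. witnesses F ps nl \<phi> M N n (butlast xs) (last xs) (butlast ys) (last ys)"
        "{f. \<forall>i. f i \<in> carrier (M i)}" "{f. \<forall>i. f i \<in> carrier (N i)}"], goal_cases)
    case (7 xs ys)
    have "carrier (M i) \<noteq> {}" "carrier (N i) \<noteq> {}" for i using M(2) N(2) by auto
    then show ?case by (auto intro: witnesses_carrier)
  next
    case (8 X Y)
    then show ?thesis using that by meson
  qed (use M N fin in \<open>auto simp: countable_witnesses model_over_def intro: countable_finite\<close>)
  obtain qM :: "(nat \<Rightarrow> 'u) \<Rightarrow> 'u" where qM: "\<And>f g. f \<in> CM \<Longrightarrow> g \<in> CM \<Longrightarrow> qM f = qM g \<longleftrightarrow> eventually (\<lambda>i. f i = g i) U"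
    using quotient_embedding[OF inf cnt(1), of U] by blast
  obtain qN :: "(nat \<Rightarrow> 'u) \<Rightarrow> 'u" where qN: "\<And>f g. f \<in> CN \<Longrightarrow> g \<in> CN \<Longrightarrow> qN f = qN g \<longleftrightarrow> eventually (\<lambda>i. f i = g i) U"
    using quotient_embedding[OF inf cnt(2), of U] by blast
  have clos: "witnesses F ps nl \<phi> N M m ns' n' ms' m' \<subseteq> CM \<and> witnesses F ps nl \<phi> M N n ms' m' ns' n' \<subseteq> CN"
    if "set ms' \<subseteq> CM" "m' \<in> CM" "set ns' \<subseteq> CN" "n' \<in> CN" for ms' m' ns' n'
    using closed[of "ms' @ [m']" "ns' @ [n']"] that by simp
  have "uagree U F ps nl M [] m N [] n"
    unfolding uagree_def
  proof
    fix c
    show "eventually (\<lambda>i. agree F ps nl c (M i) (at_index i []) (m i) (N i) (at_index i []) (n i)) U"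
      \<comment> \<open>Index \<open>i\<close> offers rank \<open>i\<close>, which includes rank
        \<open>c\<close> once \<open>c \<le> i\<close>.\<close>
      using filter_leD[OF U(2) eventually_ge_at_top[of c]]
      by eventually_elim (use agree_mono[OF ag] in simp)
  qed
  then interpret agreeing_products U PROPS NOMS M CM m qM N CN n qN F ps nl \<phi>
  proof unfold_locales
    show "U \<noteq> bot" "U \<le> sequentially" "set ps = PROPS" "set nl = NOMS" by fact+
    show "eventually P U \<or> eventually (\<lambda>i. \<not> P i) U" for P by (rule ult)
    show "model_over PROPS NOMS (M i)" "model_over PROPS NOMS (N i)" for i by (rule M N)+
    show "f i \<in> carrier (M i)" if "f \<in> CM" for f i using that CM by blast
    show "f i \<in> carrier (N i)" if "f \<in> CN" for f i using that CN by blast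
    show "m \<in> CM" "n \<in> CN" using base by blast+
    show "(\<lambda>i. nomi (M i) s) \<in> CM" "(\<lambda>i. nomi (N i) s) \<in> CN" if "s \<in> NOMS" for s
      using that base by blast+
    show "qM f = qM g \<longleftrightarrow> eventually (\<lambda>i. f i = g i) U" if "f \<in> CM" "g \<in> CM" for f g
      using that by (rule qM)
    show "qN f = qN g \<longleftrightarrow> eventually (\<lambda>i. f i = g i) U" if "f \<in> CN" "g \<in> CN" for f g
      using that by (rule qN)
    show "witnesses F ps nl \<phi> N M m ns' n' ms' m' \<subseteq> CM" "witnesses F ps nl \<phi> M N n ms' m' ns' n' \<subseteq> CN"
      if "set ms' \<subseteq> CM" "m' \<in> CM" "set ns' \<subseteq> CN" "n' \<in> CN" for ms' m' ns' n'
      using clos[OF that] by blast+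
  qed
  have "(([], qM m), ([], qN n)) \<in> bisim 0"
    by (rule bisimI[of _ "[]" _ m _ "[]" _ n]) (use MM.d NN.d start in auto)
  then have "fo_true MM.prodm (qM m) \<phi> \<longleftrightarrow> fo_true NN.prodm (qN n) \<phi>"
    using \<phi>(2) omega_bisim_bisim MM.model_over_prodm NN.model_over_prodm
    unfolding omega_bisim_invariant_def by blast
  then show False
    using fo_true_prodm[OF \<phi>(1)] sep MM.proper by (simp add: trivial_limit_def)
qed

text \<open>The implication from invariance to definability is restricted to feature sets with a
  binder, since \<open>no_binder_counterexample\<close> refutes it for all others.\<close>

theorem theorem5p9:
  fixes PROPS :: "'p set" and NOMS :: "'n set" and F :: "feature set"
    and \<phi> :: "('p, 'n) fo" and x :: nat
  assumes "infinite (UNIV :: 'u set)"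
    and "finite PROPS" and "finite NOMS"
    and "fo_over PROPS NOMS \<phi>" and "fo_fv \<phi> \<subseteq> {x}"
  shows "((\<exists>\<psi>. hsentence F PROPS NOMS \<psi> \<and> equiv_to_ST_of TYPE('u) PROPS NOMS x \<phi> \<psi>)
            \<longrightarrow> omega_bisim_invariant TYPE('u) F PROPS NOMS \<phi>)
       \<and> (Down \<in> F \<or> Ex \<in> F \<longrightarrow>
            omega_bisim_invariant TYPE('u) F PROPS NOMS \<phi>
            \<longrightarrow> (\<exists>\<psi>. hsentence F PROPS NOMS \<psi> \<and> equiv_to_ST_of TYPE('u) PROPS NOMS x \<phi> \<psi>))"
proof (intro conjI impI)
  assume "\<exists>\<psi>. hsentence F PROPS NOMS \<psi> \<and> equiv_to_ST_of TYPE('u) PROPS NOMS x \<phi> \<psi>"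
  then obtain \<psi> where \<psi>: "hsentence F PROPS NOMS \<psi>" "equiv_to_ST_of TYPE('u) PROPS NOMS x \<phi> \<psi>" by blast
  show "omega_bisim_invariant TYPE('u) F PROPS NOMS \<phi>"
    unfolding omega_bisim_invariant_def
  proof (intro allI impI)
    fix M N :: "('u, 'p, 'n) model" and B m n
    assume MN: "model_over PROPS NOMS M" "model_over PROPS NOMS N"
      and bis: "omega_bisim F PROPS NOMS M N B" and 0: "(([], m), ([], n)) \<in> B 0"
    show "fo_true M m \<phi> \<longleftrightarrow> fo_true N n \<phi>"
      using \<psi>(2)[unfolded equiv_to_ST_of_iff_htrue[OF \<psi>(1)]] MN omega_bisimD(3,6)[OF bis 0]
        hsentence_omega_bisim_invariant[OF bis MN 0 \<psi>(1)] by simp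
  qed
next
  assume F: "Down \<in> F \<or> Ex \<in> F" and inv: "omega_bisim_invariant TYPE('u) F PROPS NOMS \<phi>"
  obtain ps nl where ps: "set ps = PROPS" and nl: "set nl = NOMS"
    using assms(2,3) finite_list by metis
  show "\<exists>\<psi>. hsentence F PROPS NOMS \<psi> \<and> equiv_to_ST_of TYPE('u) PROPS NOMS x \<phi> \<psi>"
  proof (rule ccontr)
    assume undef: "\<not> ?thesis"
    \<comment> \<open>The rank is taken equal to the index; the axiom of choice then turns the pairs
      into sequences.\<close>
    have "\<forall>i. \<exists>(M :: ('u, 'p, 'n) model) N m n. model_over PROPS NOMS M \<and> m \<in> carrier M \<and>
      model_over PROPS NOMS N \<and> n \<in> carrier N \<and> agree F ps nl i M [] m N [] n \<and>
      fo_true M m \<phi> \<and> \<not> fo_true N n \<phi>"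
      using definable_or_agreeing_counterexample[OF F _ _ undef] ps nl by (metis order_refl)
    then obtain M N :: "nat \<Rightarrow> ('u, 'p, 'n) model" and m n where "\<And>i. model_over PROPS NOMS (M i) \<and> m i \<in> carrier (M i) \<and>
      model_over PROPS NOMS (N i) \<and> n i \<in> carrier (N i) \<and> agree F ps nl i (M i) [] (m i) (N i) [] (n i) \<and>
      fo_true (M i) (m i) \<phi> \<and> \<not> fo_true (N i) (n i) \<phi>"
      by metis
    then show False
      using invariant_not_separated[OF assms(1) ps nl assms(4) inv, of M m N n] by blast
  qed
qed

end
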